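(* Let $K\in\{\mathbb{R},\mathbb{C},\mathbb{H}\}$, let $d\ge 2$ and $q\in[1,2]$. Assume that there are real coefficients $a_0,a_1\ge 0$ and $a_k\le 0$ for $k\ge 2$ (finitely many of the $a_k$ nonzero, or infinitely many with the series converging for every $t\in[0,1]$) such that $$t^q\le a_0+a_1t^2+\sum_{k\ge 2}a_kQ_{K,d}^{(k)}(t)\qquad\text{for all }t\in[0,1].$$ Then for any isotropic measure $\mu$ on $K^d$, $$\mathbb{E}_{x,y\sim\mu}|\langle x,y\rangle|^q\le\frac{a_1}{d}+a_0 .$$
   Context: $K^d$ carries the Hermitian product $\langle x,y\rangle=x^*y$ ($x^*$ is the conjugate transpose; for $K=\mathbb{H}$, $K^d$ is a right vector space). An isotropic measure on $K^d$ is a Borel probability measure $\mu$ with $\mathbb{E}_{x\sim\mu}\,xx^*=\frac1d I_d$. The quantity $\mathbb{E}_{x,y\sim\mu}|\langle x,y\rangle|^q=\int\int|\langle x,y\rangle|^q\,d\mu(x)\,d\mu(y)$ is the $q$-th moment of $\mu$. $Q_{K,d}^{(k)}$ denotes the zonal spherical function of $K\mathbb{P}^{d-1}$ in the variable $t=|\langle x,y\rangle|$: $Q_{K,d}^{(k)}(t)=P_k^{(\alpha,\beta)}(2t^2-1)/P_k^{(\alpha,\beta)}(1)$, where $P_k^{(\alpha,\beta)}$ is the Jacobi polynomial of degree $k$ (orthogonal on $[-1,1]$ with weight $(1-x)^\alpha(1+x)^\beta$) with $\alpha=(d-1)\frac{\dim_{\mathbb{R}}K}{2}-1$ and $\beta=\frac{\dim_{\mathbb{R}}K}{2}-1$.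 *)

theory Defs
  imports "HOL-Probability.Probability" "HOL-Computational_Algebra.Polynomial"
begin

section \<open>Quaternions\<close>

datatype quat = Quat (Re1: real) (Im1: real) (Im2: real) (Im3: real)

lemma quat_eq_iff:
  "x = y \<longleftrightarrow> Re1 x = Re1 y \<and> Im1 x = Im1 y \<and> Im2 x = Im2 y \<and> Im3 x = Im3 y"
  by (cases x; cases y) simp

instantiation quat :: real_vector
begin

definition "0 = Quat 0 0 0 0"
definition "x + y = Quat (Re1 x + Re1 y) (Im1 x + Im1 y) (Im2 x + Im2 y) (Im3 x + Im3 y)"
definition "- x = Quat (- Re1 x) (- Im1 x) (- Im2 x) (- Im3 x)"
definition "x - (y :: quat) = x + (- y)"
definition "r *\<^sub>R x = Quat (r * Re1 x) (r * Im1 x) (r * Im2 x) (r * Im3 x)"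

instance
  by standard (simp_all add: quat_eq_iff zero_quat_def plus_quat_def uminus_quat_def
    minus_quat_def scaleR_quat_def algebra_simps)

end

instantiation quat :: real_inner
begin

definition "inner x y = Re1 x * Re1 y + Im1 x * Im1 y + Im2 x * Im2 y + Im3 x * Im3 y"
definition "norm x = sqrt (inner x (x :: quat))"
definition "sgn x = (x :: quat) /\<^sub>R norm x"
definition "dist x y = norm (x - y :: quat)"
definition
  "(uniformity :: (quat \<times> quat) filter) = (INF e\<in>{0 <..}. principal {(x, y). dist x y < e})"
definition
  "open (U :: quat set) \<longleftrightarrow> (\<forall>x\<in>U. eventually (\<lambda>(x', y). x' = x \<longrightarrow> y \<in> U) uniformity)"

instance
proof
  fix x :: quat
  have "0 \<le> (Re1 x)\<^sup>2 + (Im1 x)\<^sup>2 + (Im2 x)\<^sup>2 + (Im3 x)\<^sup>2" by simp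
  then show "0 \<le> inner x x" by (simp add: inner_quat_def power2_eq_square)
  have "a\<^sup>2 + b\<^sup>2 + c\<^sup>2 + d\<^sup>2 = 0 \<longleftrightarrow> a = 0 \<and> b = 0 \<and> c = 0 \<and> d = 0" for a b c d :: real
    by (simp add: add_nonneg_eq_0_iff)
  then show "inner x x = 0 \<longleftrightarrow> x = 0"
    by (auto simp: inner_quat_def quat_eq_iff zero_quat_def simp flip: power2_eq_square)
qed (simp_all add: quat_eq_iff zero_quat_def plus_quat_def uminus_quat_def minus_quat_def
    scaleR_quat_def inner_quat_def norm_quat_def sgn_quat_def dist_quat_def
    uniformity_quat_def open_quat_def algebra_simps)

end

instantiation quat :: euclidean_space
begin

definition "Basis = {Quat 1 0 0 0, Quat 0 1 0 0, Quat 0 0 1 0, Quat 0 0 0 1}"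

instance
proof
  fix x :: quat
  show "(\<forall>u\<in>Basis. inner x u = 0) \<longleftrightarrow> x = 0"
    by (simp add: Basis_quat_def inner_quat_def zero_quat_def quat_eq_iff[of x])
qed (auto simp: Basis_quat_def inner_quat_def)

end

lemma DIM_quat [simp]: "DIM(quat) = 4"
  by (simp add: Basis_quat_def)

instantiation quat :: real_normed_div_algebra
begin

definition "1 = Quat 1 0 0 0"

definition "x * y = Quat
  (Re1 x * Re1 y - Im1 x * Im1 y - Im2 x * Im2 y - Im3 x * Im3 y)
  (Re1 x * Im1 y + Im1 x * Re1 y + Im2 x * Im3 y - Im3 x * Im2 y)
  (Re1 x * Im2 y - Im1 x * Im3 y + Im2 x * Re1 y + Im3 x * Im1 y)
  (Re1 x * Im3 y + Im1 x * Im2 y - Im2 x * Im1 y + Im3 x * Re1 y)"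

definition "inverse x = Quat (Re1 x) (- Im1 x) (- Im2 x) (- Im3 x) /\<^sub>R (norm x)\<^sup>2"
definition "x div (y :: quat) = x * inverse y"

instance
proof
  fix x y :: quat
  have sq: "(norm x)\<^sup>2 = Re1 x * Re1 x + Im1 x * Im1 x + Im2 x * Im2 x + Im3 x * Im3 x" for x :: quat
    by (simp add: power2_norm_eq_inner inner_quat_def)
  show "inverse x * x = 1" "x * inverse x = 1" if "x \<noteq> 0"
  proof -
    have "(norm x)\<^sup>2 \<noteq> 0" using that by simp
    then show "inverse x * x = 1" "x * inverse x = 1"
      by (auto simp: quat_eq_iff times_quat_def inverse_quat_def one_quat_def scaleR_quat_def
          field_simps) (simp_all add: sq algebra_simps)
  qed
  have "(norm (x * y))\<^sup>2 = (norm x * norm y)\<^sup>2"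
    unfolding power_mult_distrib sq by (simp add: times_quat_def algebra_simps)
  then show "norm (x * y) = norm x * norm y"
    by (simp add: power2_eq_iff_nonneg)
qed (simp_all add: quat_eq_iff zero_quat_def one_quat_def plus_quat_def
    scaleR_quat_def times_quat_def divide_quat_def inverse_quat_def algebra_simps)

end


section \<open>The scalars: real and complex numbers, quaternions\<close>

class hermitian_scalar = real_normed_div_algebra + euclidean_space +
  fixes hconj :: "'a \<Rightarrow> 'a"
  assumes hconj_add: "hconj (x + y) = hconj x + hconj y"
    and hconj_mult: "hconj (x * y) = hconj y * hconj x"
    and hconj_mult_self: "hconj x * x = (norm x)\<^sup>2 *\<^sub>R 1"

instantiation real :: hermitian_scalar
begin
definition hconj_real :: "real \<Rightarrow> real" where [simp]: "hconj_real x = x"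
instance by standard (auto simp: power2_eq_square)
end

instantiation complex :: hermitian_scalar
begin
definition hconj_complex :: "complex \<Rightarrow> complex" where [simp]: "hconj_complex = cnj"
instance
proof
  fix x :: complex
  show "hconj x * x = (norm x)\<^sup>2 *\<^sub>R 1"
    using complex_norm_square[of x] by (simp add: scaleR_conv_of_real mult.commute)
qed simp_all
end

instantiation quat :: hermitian_scalar
begin
definition hconj_quat :: "quat \<Rightarrow> quat" where
  "hconj_quat x = Quat (Re1 x) (- Im1 x) (- Im2 x) (- Im3 x)"
instance
proof
  fix x y :: quat
  show "hconj (x + y) = hconj x + hconj y"
    by (simp add: quat_eq_iff hconj_quat_def plus_quat_def)
  show "hconj (x * y) = hconj y * hconj x"
    by (simp add: quat_eq_iff hconj_quat_def times_quat_def)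
  have "(norm x)\<^sup>2 = Re1 x * Re1 x + Im1 x * Im1 x + Im2 x * Im2 x + Im3 x * Im3 x"
    unfolding power2_norm_eq_inner inner_quat_def ..
  then show "hconj x * x = (norm x)\<^sup>2 *\<^sub>R 1"
    by (simp add: quat_eq_iff hconj_quat_def times_quat_def scaleR_quat_def one_quat_def)
qed
end


section \<open>Isotropic measures and their moments\<close>

definition hinner :: "'k::hermitian_scalar ^ 'n \<Rightarrow> 'k ^ 'n \<Rightarrow> 'k"
  where "hinner x y = (\<Sum>i\<in>UNIV. hconj (x $ i) * y $ i)"

definition outer_square :: "'k::hermitian_scalar ^ 'n \<Rightarrow> 'k ^ 'n ^ 'n"
  where "outer_square x = (\<chi> i j. x $ i * hconj (x $ j))"

text \<open>Integrability is demanded explicitly because the Bochner integral of a non-integrable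
  function is \<open>0\<close>.\<close>

definition isotropic :: "('k::hermitian_scalar ^ 'n) measure \<Rightarrow> bool"
  where "isotropic \<mu> \<longleftrightarrow> prob_space \<mu> \<and> sets \<mu> = sets borel \<and>
    integrable \<mu> outer_square \<and>
    (\<integral>x. outer_square x \<partial>\<mu>) = (1 / real CARD('n)) *\<^sub>R mat 1"

text \<open>The integrand is nonnegative, so the moment is a Lebesgue integral with values in
  \<open>[0, \<infinity>]\<close>; an upper bound for it includes the assertion that it is finite.\<close>

definition moment :: "real \<Rightarrow> ('k::hermitian_scalar ^ 'n) measure \<Rightarrow> ennreal"
  where "moment q \<mu> = (\<integral>\<^sup>+y. \<integral>\<^sup>+x. ennreal (norm (hinner x y) powr q) \<partial>\<mu> \<partial>\<mu>)"


section \<open>Zonal functions\<close>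

text \<open>The explicit formula for the Jacobi polynomials in their standard normalisation; the lemmas
  below confirm the orthogonality relation and that it can be normalised at \<open>1\<close>.\<close>

definition jacobi :: "nat \<Rightarrow> real \<Rightarrow> real \<Rightarrow> real \<Rightarrow> real"
  where "jacobi k \<alpha> \<beta> x = (\<Sum>s\<le>k. ((real k + \<alpha>) gchoose (k - s)) * ((real k + \<beta>) gchoose s) *
    ((x - 1) / 2) ^ s * ((x + 1) / 2) ^ (k - s))"

text \<open>The zonal spherical function of \<open>K\<close>-projective space of dimension \<open>d - 1\<close>, where
  \<open>m\<close> is the real dimension of \<open>K\<close>.\<close>

definition zonal :: "nat \<Rightarrow> nat \<Rightarrow> nat \<Rightarrow> real \<Rightarrow> real"
  where "zonal m d k t =
    (let \<alpha> = (real d - 1) * (real m / 2) - 1; \<beta> = real m / 2 - 1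
     in jacobi k \<alpha> \<beta> (2 * t\<^sup>2 - 1) / jacobi k \<alpha> \<beta> 1)"

lemma jacobi_at_1: "jacobi k \<alpha> \<beta> 1 = (real k + \<alpha>) gchoose k"
proof -
  have "jacobi k \<alpha> \<beta> 1 = (\<Sum>s\<le>k. if s = 0 then (real k + \<alpha>) gchoose k else 0)"
    unfolding jacobi_def by (rule sum.cong) (auto simp: power_0_left)
  then show ?thesis by simp
qed

lemma jacobi_at_1_pos: "jacobi k \<alpha> \<beta> 1 > 0" if "\<alpha> > -1"
  using that by (auto simp: jacobi_at_1 gbinomial_prod_rev intro!: prod_pos divide_pos_pos)

lemma pochhammer_backward_difference:
  "pochhammer y (Suc m) - pochhammer (y - 1) (Suc m) = real (Suc m) * pochhammer (y :: real) m"
proof -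
  have "pochhammer (y - 1) (Suc m) = (y - 1) * pochhammer y m"
    by (simp add: pochhammer_rec)
  moreover have "pochhammer y (Suc m) = pochhammer y m * (y + real m)"
    by (simp add: pochhammer_Suc)
  ultimately show ?thesis by (simp add: algebra_simps)
qed

lemma alternating_sum_pochhammer:
  "m < k \<Longrightarrow> (\<Sum>s\<le>k. (-1) ^ s * real (k choose s) * pochhammer (c - real s) m) = 0"
proof (induction k arbitrary: m)
  case (Suc k)
  have pascal: "(\<Sum>s\<le>Suc k. (-1) ^ s * real (Suc k choose s) * f s) =
      (\<Sum>s\<le>k. (-1) ^ s * real (k choose s) * (f s - f (Suc s)))" for f :: "nat \<Rightarrow> real"
  proof -
    have "(\<Sum>s\<le>Suc k. (-1) ^ s * real (Suc k choose s) * f s) =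
        f 0 + (\<Sum>s\<le>k. (-1) ^ Suc s * real (Suc k choose Suc s) * f (Suc s))"
      by (subst sum.atMost_Suc_shift) simp
    also have "(\<Sum>s\<le>k. (-1) ^ Suc s * real (Suc k choose Suc s) * f (Suc s)) =
        (\<Sum>s\<le>k. (-1) ^ Suc s * real (k choose s) * f (Suc s)) +
        (\<Sum>s\<le>k. (-1) ^ Suc s * real (k choose Suc s) * f (Suc s))"
      unfolding sum.distrib[symmetric] by (rule sum.cong) (simp_all add: algebra_simps)
    also have "f 0 + (\<dots>) = (\<Sum>s\<le>k. (-1) ^ Suc s * real (k choose s) * f (Suc s)) +
        (\<Sum>s\<le>Suc k. (-1) ^ s * real (k choose s) * f s)"
      unfolding sum.atMost_Suc_shift[of "\<lambda>s. (-1) ^ s * real (k choose s) * f s"] by simp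
    also have "\<dots> = (\<Sum>s\<le>k. (-1) ^ s * real (k choose s) * (f s - f (Suc s)))"
      by (simp add: sum_subtractf right_diff_distrib sum_negf)
    finally show ?thesis .
  qed
  show ?case
  proof (cases m)
    case 0
    then show ?thesis by (simp only: pascal) simp
  next
    case (Suc m')
    have "pochhammer (c - real s) (Suc m') - pochhammer (c - real (Suc s)) (Suc m') =
        real (Suc m') * pochhammer (c - real s) m'" for s
      using pochhammer_backward_difference[of "c - real s" m'] by (simp add: algebra_simps)
    then have "(\<Sum>s\<le>Suc k. (-1) ^ s * real (Suc k choose s) * pochhammer (c - real s) m) =
        real (Suc m') * (\<Sum>s\<le>k. (-1) ^ s * real (k choose s) * pochhammer (c - real s) m')"
      by (simp only: pascal Suc) (simp add: sum_distrib_left mult_ac)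
    then show ?thesis using Suc.IH[of m'] Suc.prems Suc by simp
  qed
qed simp

lemma jacobi_orthogonal_unit_interval:
  assumes "\<alpha> > -1" "\<beta> > -1" "m < k"
  shows "((\<lambda>u. (1 - u) powr \<alpha> * u powr \<beta> * jacobi k \<alpha> \<beta> (2 * u - 1) * u ^ m) has_integral 0) {0..1}"
proof -
  define A where "A s = (-1) ^ s * ((real k + \<alpha>) gchoose (k - s)) * ((real k + \<beta>) gchoose s)" for s
  let ?B = "\<lambda>s. Beta (\<beta> + real (k - s) + real m + 1) (\<alpha> + real s + 1)"
  have "((\<lambda>u. \<Sum>s\<le>k. A s * (u powr (\<beta> + real (k - s) + real m + 1 - 1) *
      (1 - u) powr (\<alpha> + real s + 1 - 1))) has_integral (\<Sum>s\<le>k. A s * ?B s)) {0..1}"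
    using assms by (intro has_integral_sum has_integral_mult_right has_integral_Beta_real) auto
  also have "(\<Sum>s\<le>k. A s * ?B s) = 0"
  proof -
    define C where "C = Gamma (real k + \<alpha> + 1) * Gamma (real k + \<beta> + 1) /
      (fact k * Gamma (\<alpha> + \<beta> + real k + real m + 2))"
    have nonpos: "x \<notin> \<int>\<^sub>\<le>\<^sub>0" if "x > 0" for x :: real
      using that by (auto simp: nonpos_Ints_def)
    have "A s * ?B s =
        C * ((-1) ^ s * real (k choose s) * pochhammer ((real k + \<beta> + 1) - real s) m)"
      if "s \<le> k" for s
    proof -
      have 1: "(real k + \<alpha>) gchoose (k - s) =
          Gamma (real k + \<alpha> + 1) / (fact (k - s) * Gamma (\<alpha> + real s + 1))"
        using assms that by (subst gbinomial_Gamma) (auto intro!: nonpos simp: of_nat_diff add_ac)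
      have 2: "(real k + \<beta>) gchoose s =
          Gamma (real k + \<beta> + 1) / (fact s * Gamma (\<beta> + real (k - s) + 1))"
        using assms that
        by (subst gbinomial_Gamma) (auto intro!: nonpos simp: of_nat_diff algebra_simps)
      have 3: "pochhammer ((real k + \<beta> + 1) - real s) m =
          Gamma (\<beta> + real (k - s) + real m + 1) / Gamma (\<beta> + real (k - s) + 1)"
        using assms that
        by (subst pochhammer_Gamma) (auto intro!: nonpos simp: of_nat_diff algebra_simps)
      have 4: "?B s = Gamma (\<beta> + real (k - s) + real m + 1) * Gamma (\<alpha> + real s + 1) /
          Gamma (\<alpha> + \<beta> + real k + real m + 2)"
        using that by (simp add: Beta_def of_nat_diff algebra_simps)
      have 5: "real (k choose s) = fact k / (fact s * fact (k - s))"
        using that by (rule binomial_fact)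
      have "Gamma (\<alpha> + real s + 1) > 0"
        using assms by (intro Gamma_real_pos) auto
      then show ?thesis
        unfolding A_def C_def 1 2 3 4 5 by (simp add: field_simps)
    qed
    then have "(\<Sum>s\<le>k. A s * ?B s) = C * (\<Sum>s\<le>k. (-1) ^ s * real (k choose s) *
        pochhammer ((real k + \<beta> + 1) - real s) m)"
      by (simp add: sum_distrib_left)
    then show ?thesis
      using alternating_sum_pochhammer[OF assms(3)] by simp
  qed
  finally have "((\<lambda>u. \<Sum>s\<le>k. A s * (u powr (\<beta> + real (k - s) + real m + 1 - 1) *
      (1 - u) powr (\<alpha> + real s + 1 - 1))) has_integral 0) {0..1}" .
  then show ?thesis
  proof (rule has_integral_spike_finite[where S = "{0, 1}", rotated 2])
    fix u :: real
    assume "u \<in> {0..1} - {0, 1}"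
    then have u: "u > 0" "1 - u > 0" by auto
    have "A s * (u powr (\<beta> + real (k - s) + real m + 1 - 1) * (1 - u) powr (\<alpha> + real s + 1 - 1)) =
        (1 - u) powr \<alpha> * u powr \<beta> * (((real k + \<alpha>) gchoose (k - s)) * ((real k + \<beta>) gchoose s) *
          ((2 * u - 1 - 1) / 2) ^ s * ((2 * u - 1 + 1) / 2) ^ (k - s)) * u ^ m" for s
    proof -
      have "((2 * u - 1 - 1) / 2) ^ s = (-1) ^ s * (1 - u) ^ s"
        by (simp add: power_mult_distrib[symmetric] diff_divide_distrib)
      then show ?thesis
        using u by (simp add: A_def powr_add powr_realpow mult_ac)
    qed
    then show "(1 - u) powr \<alpha> * u powr \<beta> * jacobi k \<alpha> \<beta> (2 * u - 1) * u ^ m =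
        (\<Sum>s\<le>k. A s * (u powr (\<beta> + real (k - s) + real m + 1 - 1) *
          (1 - u) powr (\<alpha> + real s + 1 - 1)))"
      by (simp only: jacobi_def sum_distrib_left sum_distrib_right)
  qed simp
qed

lemma jacobi_orthogonal:
  fixes p :: "real poly"
  assumes "\<alpha> > -1" "\<beta> > -1" "degree p < k"
  shows "((\<lambda>x. (1 - x) powr \<alpha> * (1 + x) powr \<beta> * jacobi k \<alpha> \<beta> x * poly p x) has_integral 0) {-1..1}"
proof -
  define r where "r = pcompose p [:-1, 2:]"
  have r: "poly r u = poly p (2 * u - 1)" for u
    by (simp add: r_def poly_pcompose mult.commute)
  have "degree r < k"
    using assms(3) degree_pcompose_le[of p "[:-1, 2:]"] by (simp add: r_def)
  then have "((\<lambda>u. \<Sum>i\<le>degree r. coeff r i *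
      ((1 - u) powr \<alpha> * u powr \<beta> * jacobi k \<alpha> \<beta> (2 * u - 1) * u ^ i)) has_integral
      (\<Sum>i\<le>degree r. coeff r i * 0)) {0..1}"
    using assms
    by (intro has_integral_sum has_integral_mult_right jacobi_orthogonal_unit_interval) auto
  then have "((\<lambda>u. (1 - u) powr \<alpha> * u powr \<beta> * jacobi k \<alpha> \<beta> (2 * u - 1) * poly r u) has_integral 0)
      (cbox 0 1)"
    by (simp add: poly_altdef sum_distrib_left mult_ac)
  from has_integral_affinity[OF this, of "1/2" "1/2"]
  have "((\<lambda>x. (1 - (x / 2 + 1 / 2)) powr \<alpha> * (x / 2 + 1 / 2) powr \<beta> *
      jacobi k \<alpha> \<beta> (2 * (x / 2 + 1 / 2) - 1) * poly r (x / 2 + 1 / 2)) has_integral 0) {-1..1}"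
    by (simp add: image_affinity_atLeastAtMost_diff cbox_interval)
  from has_integral_mult_right[OF this, of "2 powr \<alpha> * 2 powr \<beta>"]
  have "((\<lambda>x. 2 powr \<alpha> * 2 powr \<beta> * ((1 - (x / 2 + 1 / 2)) powr \<alpha> * (x / 2 + 1 / 2) powr \<beta> *
      jacobi k \<alpha> \<beta> (2 * (x / 2 + 1 / 2) - 1) * poly r (x / 2 + 1 / 2))) has_integral 0) {-1..1}"
    by simp
  then show ?thesis
  proof (rule has_integral_eq[rotated])
    fix x :: real
    assume x: "x \<in> {-1..1}"
    have 1: "2 powr \<alpha> * (1 - (x / 2 + 1 / 2)) powr \<alpha> = (1 - x) powr \<alpha>"
      using x by (subst powr_mult[symmetric]) (auto intro!: arg_cong[where f = "\<lambda>x. x powr _"])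
    have 2: "2 powr \<beta> * (x / 2 + 1 / 2) powr \<beta> = (1 + x) powr \<beta>"
      using x by (subst powr_mult[symmetric]) (auto intro!: arg_cong[where f = "\<lambda>x. x powr _"])
    have 3: "2 * (x / 2 + 1 / 2) - 1 = x" by simp
    have "a * b * (c * d * e * f) = (a * c) * (b * d) * e * f" for a b c d e f :: real
      by (simp only: mult_ac)
    then show "2 powr \<alpha> * 2 powr \<beta> * ((1 - (x / 2 + 1 / 2)) powr \<alpha> *
        (x / 2 + 1 / 2) powr \<beta> * jacobi k \<alpha> \<beta> (2 * (x / 2 + 1 / 2) - 1) *
        poly r (x / 2 + 1 / 2)) =
        (1 - x) powr \<alpha> * (1 + x) powr \<beta> * jacobi k \<alpha> \<beta> x * poly p x"
      by (simp only: r 1 2 3)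
  qed
qed

end

theory Submission
  imports Defs
begin

text \<open>Write \<open>x = r u\<close>, \<open>y = s v\<close> with unit vectors \<open>u\<close>, \<open>v\<close>, multiply the assumed inequality at
  \<open>t = norm (hinner u v)\<close> by \<open>(r * s) powr q\<close> and integrate. The zonal terms of degree at least \<open>2\<close>
  contribute a nonpositive amount because zonal functions are positive definite. Since
  \<open>(r * s) powr q\<close> is at most \<open>(2 - q) / 2 * (r\<^sup>2 + s\<^sup>2) + (q - 1) * r\<^sup>2 * s\<^sup>2\<close>, isotropy bounds the first
  two terms by \<open>a 0\<close> and \<open>a 1 / d\<close>.

  Positive definiteness follows from the identity that the convolution of a zonal function with
  itself over a random unit vector is a positive multiple of the function. Convolutions of the
  powers \<open>t ^ (2 * i)\<close> and \<open>t ^ (2 * j)\<close> are computed by polarising a single even moment of a real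
  random unit vector and averaging over the unit scalars; in these terms the identity is the
  Chu--Vandermonde summation formula.\<close>

section \<open>Hypergeometric form of the zonal functions\<close>

text \<open>The vectors have no prescribed length, so the weight \<open>(r * s) powr q\<close>
  cannot be replaced by a bound throughout: positive definiteness needs it in the product form
  \<open>w x * w y\<close>, and the zonal terms with \<open>k \<ge> 2\<close> are disposed of by the
  sign of their integrals. Only the two terms with nonnegative coefficients tolerate an upper bound
  of the weight. Its constants come from q = (2 - q) * 1 + (q - 1) * 2, and since r and s have mean
  square 1 the bound integrates to (2 - q) + (q - 1) = 1. The role of the uniform measure on the
  sphere is played by any random unit vector whose moment of order \<open>4 * k\<close> is rotation
  invariant: the convolution for a given \<open>k\<close> involves no higher moments, and the lower
  even ones follow. Likewise the scalars enter only through half their real dimension: the real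
  computation has 1/2 in this place, and averaging over unit scalars replaces it by
  \<open>p\<close>.\<close>

definition zonal_coeff :: "nat \<Rightarrow> real \<Rightarrow> real \<Rightarrow> nat \<Rightarrow> real"
  where "zonal_coeff k L p i =
    pochhammer (- real k) i * pochhammer (real k + L) i / (pochhammer p i * fact i)"

text \<open>Here \<open>p\<close> and \<open>n\<close> are half the real dimensions of the scalars
  and of the vector space. Up to the total mass this is the coefficient of
  \<open>norm (hinner u v) ^ (2 * l)\<close> in the mean of
  \<open>norm (hinner u _) ^ (2 * i) * norm (hinner v _) ^ (2 * j)\<close> over a random unit
  vector.\<close>

definition moment_coeff :: "real \<Rightarrow> real \<Rightarrow> nat \<Rightarrow> nat \<Rightarrow> nat \<Rightarrow> real"
  where "moment_coeff p n i j l =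
    fact i * pochhammer p i * (fact j * pochhammer p j) /
    (pochhammer n (i + j) * fact (i - l) * fact (j - l) * (fact l * pochhammer p l))"

lemma pochhammer_minus_nat:
  assumes "i \<le> k"
  shows "pochhammer (- real k) i = (-1) ^ i * fact k / fact (k - i)"
proof -
  have "pochhammer (- real k) i = (-1) ^ i * fact i * (real k gchoose i)"
    by (simp add: gbinomial_pochhammer mult.assoc flip: power_add)
  also have "real k gchoose i = fact k / (fact i * fact (k - i))"
    using assms by (metis binomial_fact binomial_gbinomial)
  finally show ?thesis by simp
qed

lemma zonal_coeff_gbinomial:
  assumes "i \<le> k" "p > 0"
  shows "(-1) ^ (k - i) * ((real k + p - 1) gchoose (k - i)) * ((real k + real i + L - 1) gchoose i)
    = (-1) ^ k * pochhammer p k / fact k * zonal_coeff k L p i"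
proof -
  have 1: "(real k + p - 1) gchoose (k - i) = pochhammer (p + real i) (k - i) / fact (k - i)"
    using assms by (simp add: gbinomial_pochhammer' of_nat_diff algebra_simps)
  have 2: "(real k + real i + L - 1) gchoose i = pochhammer (real k + L) i / fact i"
    by (simp add: gbinomial_pochhammer' algebra_simps)
  have 3: "pochhammer p k = pochhammer p i * pochhammer (p + real i) (k - i)"
    using assms by (simp add: pochhammer_product)
  have 4: "(-1) ^ k = (-1 :: real) ^ i * (-1) ^ (k - i)"
    using assms by (simp flip: power_add)
  have 5: "(-1 :: real) ^ i * (-1) ^ i = 1" by (simp flip: power_add)
  have "pochhammer p i > 0" using assms by (simp add: pochhammer_pos)
  then show ?thesis
    unfolding zonal_coeff_def 1 2 3 4 pochhammer_minus_nat[OF assms(1)]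
    using 5 by (simp add: field_simps)
qed

text \<open>With z = (1 + x) / 2 this is the terminating Gauss series 2F1(-k, k + L; p; z), where L
  = \<alpha> + \<beta> + 1 and p = \<beta> + 1. It is centred at x = -1 because for z =
  \<open>t\<^sup>2\<close> the summands are then the powers \<open>t ^ (2 * i)\<close>, whose
  convolutions are computable.\<close>

lemma jacobi_hypergeometric:
  assumes "\<beta> > -1"
  shows "jacobi k \<alpha> \<beta> (2 * z - 1) = (-1) ^ k * pochhammer (\<beta> + 1) k / fact k *
    (\<Sum>i\<le>k. zonal_coeff k (\<alpha> + \<beta> + 1) (\<beta> + 1) i * z ^ i)"
proof -
  define A where "A s = ((real k + \<alpha>) gchoose (k - s)) * ((real k + \<beta>) gchoose s)" for s
  \<comment> \<open>Trinomial revision splits off a factor free of \<open>s\<close>; what is left is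
    a Vandermonde convolution.\<close>
  have inner: "(\<Sum>s=r..k. A s * real (s choose r)) =
      ((real k + \<beta>) gchoose r) * ((2 * real k + \<alpha> + \<beta> - real r) gchoose (k - r))"
    if "r \<le> k" for r
  proof -
    have "A s * real (s choose r) = ((real k + \<beta>) gchoose r) *
        (((real k + \<beta> - real r) gchoose (s - r)) * ((real k + \<alpha>) gchoose (k - s)))"
      if "s \<in> {r..k}" for s
      using gbinomial_trinomial_revision[of r s "real k + \<beta>"] that
      by (simp add: A_def binomial_gbinomial mult_ac)
    then have "(\<Sum>s=r..k. A s * real (s choose r)) = ((real k + \<beta>) gchoose r) *
        (\<Sum>s=r..k. ((real k + \<beta> - real r) gchoose (s - r)) * ((real k + \<alpha>) gchoose (k - s)))"
      by (simp add: sum_distrib_left)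
    also have "(\<Sum>s=r..k. ((real k + \<beta> - real r) gchoose (s - r)) * ((real k + \<alpha>) gchoose (k - s)))
        = (\<Sum>q=0..k-r. ((real k + \<beta> - real r) gchoose q) * ((real k + \<alpha>) gchoose (k - r - q)))"
      using that by (intro sum.reindex_bij_witness[of _ "\<lambda>q. q + r" "\<lambda>s. s - r"]) auto
    also have "\<dots> = (2 * real k + \<alpha> + \<beta> - real r) gchoose (k - r)"
      by (subst gbinomial_Vandermonde) (simp add: algebra_simps)
    finally show ?thesis .
  qed
  have "jacobi k \<alpha> \<beta> (2 * z - 1) = (\<Sum>s\<le>k. A s * (z - 1) ^ s * z ^ (k - s))"
    unfolding jacobi_def A_def by (intro sum.cong) (simp_all add: diff_divide_distrib)
  also have "\<dots> = (\<Sum>s\<le>k. \<Sum>r\<le>s. A s * real (s choose r) * (-1) ^ r * z ^ (k - r))"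
  proof (intro sum.cong refl)
    fix s assume "s \<in> {..k}"
    have "(z - 1) ^ s = (\<Sum>r\<le>s. real (s choose r) * (-1) ^ r * z ^ (s - r))"
      using binomial_ring[of "-1" z s] by (simp add: add.commute)
    then have "A s * (z - 1) ^ s * z ^ (k - s) =
        (\<Sum>r\<le>s. A s * real (s choose r) * (-1) ^ r * (z ^ (s - r) * z ^ (k - s)))"
      by (simp add: sum_distrib_left sum_distrib_right mult_ac)
    also have "\<dots> = (\<Sum>r\<le>s. A s * real (s choose r) * (-1) ^ r * z ^ (k - r))"
      using \<open>s \<in> {..k}\<close> by (intro sum.cong) (simp_all flip: power_add)
    finally show "A s * (z - 1) ^ s * z ^ (k - s) =
        (\<Sum>r\<le>s. A s * real (s choose r) * (-1) ^ r * z ^ (k - r))" .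
  qed
  also have "\<dots> = (\<Sum>s\<le>k. \<Sum>r\<in>{r\<in>{..k}. r \<le> s}. A s * real (s choose r) * (-1) ^ r * z ^ (k - r))"
    by (intro sum.cong) auto
  also have "\<dots> = (\<Sum>r\<le>k. \<Sum>s\<in>{s\<in>{..k}. r \<le> s}. A s * real (s choose r) * (-1) ^ r * z ^ (k - r))"
    by (rule sum.swap_restrict) auto
  also have "\<dots> = (\<Sum>r\<le>k. \<Sum>s=r..k. A s * real (s choose r) * (-1) ^ r * z ^ (k - r))"
    by (intro sum.cong) auto
  also have "\<dots> = (\<Sum>r\<le>k. (-1) ^ r * ((real k + \<beta>) gchoose r) *
      ((2 * real k + \<alpha> + \<beta> - real r) gchoose (k - r)) * z ^ (k - r))"
    by (intro sum.cong refl, simp flip: sum_distrib_right) (simp add: inner mult_ac)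
  also have "\<dots> = (\<Sum>i\<le>k. (-1) ^ (k - i) * ((real k + (\<beta> + 1) - 1) gchoose (k - i)) *
      ((real k + real i + (\<alpha> + \<beta> + 1) - 1) gchoose i) * z ^ i)"
    by (intro sum.reindex_bij_witness[of _ "\<lambda>i. k - i" "\<lambda>i. k - i"])
      (auto simp: of_nat_diff algebra_simps)
  also have "\<dots> = (\<Sum>i\<le>k. (-1) ^ k * pochhammer (\<beta> + 1) k / fact k *
      zonal_coeff k (\<alpha> + \<beta> + 1) (\<beta> + 1) i * z ^ i)"
    using assms by (intro sum.cong refl, subst zonal_coeff_gbinomial) auto
  finally show ?thesis by (simp add: sum_distrib_left mult_ac)
qed

text \<open>After the shift i = l + s the factors \<open>fact i * pochhammer p i\<close> cancel and
  a 2F1 at 1 remains, which Chu--Vandermonde evaluates. Its numerator is a product of consecutive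
  integers from 1 + j - k to j - l, which contains 0 when j < k. This vanishing expresses that the
  zonal polynomial of degree \<open>k\<close> is orthogonal to the lower powers.\<close>

lemma sum_zonal_coeff_moment_coeff:
  assumes "l \<le> j" "j \<le> k" "L \<ge> 0" "p > 0"
  shows "(\<Sum>i=l..k. zonal_coeff k L p i * moment_coeff p (L + 1) i j l) =
    (if j < k then 0
     else fact k * pochhammer p k / pochhammer (L + 1) (2 * k) * zonal_coeff k L p l)"
proof -
  define D where "D = fact j * pochhammer p j / (fact (j - l) * (fact l * pochhammer p l)) *
    (pochhammer (- real k) l * pochhammer (real k + L) l / pochhammer (L + 1) (l + j))"
  let ?n = "k - l"
  have pos: "pochhammer (x :: real) i > 0" if "x > 0" for x i
    using that by (rule pochhammer_pos)
  have kl: "real ?n = real k - real l" using assms by (simp add: of_nat_diff)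
  have "(\<Sum>i=l..k. zonal_coeff k L p i * moment_coeff p (L + 1) i j l) =
      (\<Sum>s=0..?n. zonal_coeff k L p (l + s) * moment_coeff p (L + 1) (l + s) j l)"
    using assms by (intro sum.reindex_bij_witness[of _ "\<lambda>s. l + s" "\<lambda>i. i - l"]) auto
  also have "\<dots> = (\<Sum>s=0..?n. D * (pochhammer (real k + L + real l) s * pochhammer (- real ?n) s /
      (fact s * pochhammer (L + 1 + real (l + j)) s)))"
  proof (intro sum.cong refl)
    fix s
    have 1: "pochhammer (- real k) (l + s) = pochhammer (- real k) l * pochhammer (- real ?n) s"
      by (subst pochhammer_product'[of _ l s]) (simp add: kl)
    have 2: "pochhammer (real k + L) (l + s) =
        pochhammer (real k + L) l * pochhammer (real k + L + real l) s"
      by (rule pochhammer_product')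
    have 3: "pochhammer (L + 1) (l + s + j) =
        pochhammer (L + 1) (l + j) * pochhammer (L + 1 + real (l + j)) s"
      using pochhammer_product'[of "L + 1" "l + j" s] by (simp add: add_ac)
    have "pochhammer p (l + s) > 0" using assms pos by auto
    then show "zonal_coeff k L p (l + s) * moment_coeff p (L + 1) (l + s) j l =
        D * (pochhammer (real k + L + real l) s * pochhammer (- real ?n) s /
        (fact s * pochhammer (L + 1 + real (l + j)) s))"
      unfolding zonal_coeff_def moment_coeff_def D_def 1 2 3 by (simp add: mult_ac)
  qed
  also have "\<dots> = D * (pochhammer (L + 1 + real (l + j) - (real k + L + real l)) ?n /
      pochhammer (L + 1 + real (l + j)) ?n)"
  proof -
    have "\<forall>i\<in>{0..<?n}. L + 1 + real (l + j) \<noteq> - real i"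
      using assms by (smt (verit) of_nat_0_le_iff)
    from Vandermonde_pochhammer[OF this, of "real k + L + real l"]
    show ?thesis unfolding of_nat_fact sum_distrib_left[symmetric] by (rule arg_cong)
  qed
  also have "L + 1 + real (l + j) - (real k + L + real l) = 1 + real j - real k" by simp
  finally have eq: "(\<Sum>i=l..k. zonal_coeff k L p i * moment_coeff p (L + 1) i j l) =
    D * (pochhammer (1 + real j - real k) ?n / pochhammer (L + 1 + real (l + j)) ?n)" .
  show ?thesis
  proof (cases "j < k")
    case True
    have "1 + real j - real k = - real (k - 1 - j)"
      using True by (simp add: of_nat_diff)
    moreover have "k - 1 - j < ?n" using True assms by simp
    ultimately have "pochhammer (1 + real j - real k) ?n = 0"
      by (metis pochhammer_of_nat_eq_0_lemma)
    with eq True show ?thesis by simp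
  next
    case False
    then have [simp]: "j = k" using assms by simp
    have 1: "pochhammer (1 + real j - real k) ?n = fact ?n" by (simp add: pochhammer_fact)
    have 2: "pochhammer (L + 1) (2 * k) =
        pochhammer (L + 1) (l + k) * pochhammer (L + 1 + real (l + k)) (k - l)"
      using assms pochhammer_product'[of "L + 1" "l + k" "k - l"] by (simp add: mult_2)
    show ?thesis unfolding eq 1 using 2 False
      by (simp add: D_def zonal_coeff_def mult_ac)
  qed
qed

text \<open>Convolution with the powers j < k gives 0, so of the second factor only the leading term
  contributes. Hence the leading coefficient \<open>zonal_coeff k L p k\<close> appears in the
  constant.\<close>

lemma zonal_coeff_composition:
  assumes "L \<ge> 0" "p > 0"
  shows "(\<Sum>i\<le>k. \<Sum>j\<le>k. zonal_coeff k L p i * zonal_coeff k L p j *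
      (\<Sum>l\<le>min i j. moment_coeff p (L + 1) i j l * z ^ l)) =
    zonal_coeff k L p k * (fact k * pochhammer p k / pochhammer (L + 1) (2 * k)) *
      (\<Sum>l\<le>k. zonal_coeff k L p l * z ^ l)"
proof -
  let ?h = "zonal_coeff k L p" and ?m = "moment_coeff p (L + 1)"
  have *: "(\<Sum>i\<le>k. ?h i * (\<Sum>l\<le>min i j. ?m i j l * z ^ l)) =
      (if j < k then 0 else fact k * pochhammer p k / pochhammer (L + 1) (2 * k) *
        (\<Sum>l\<le>k. ?h l * z ^ l))" if "j \<le> k" for j
  proof -
    have "(\<Sum>i\<le>k. ?h i * (\<Sum>l\<le>min i j. ?m i j l * z ^ l)) =
        (\<Sum>i\<le>k. \<Sum>l\<in>{l\<in>{..j}. l \<le> i}. ?h i * ?m i j l * z ^ l)"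
      unfolding sum_distrib_left by (intro sum.cong) (auto simp: mult_ac)
    also have "\<dots> = (\<Sum>l\<le>j. \<Sum>i\<in>{i\<in>{..k}. l \<le> i}. ?h i * ?m i j l * z ^ l)"
      by (rule sum.swap_restrict) auto
    also have "\<dots> = (\<Sum>l\<le>j. z ^ l * (\<Sum>i=l..k. ?h i * ?m i j l))"
      unfolding sum_distrib_left by (intro sum.cong) (auto simp: mult_ac)
    also have "\<dots> = (\<Sum>l\<le>j. z ^ l * (if j < k then 0
        else fact k * pochhammer p k / pochhammer (L + 1) (2 * k) * ?h l))"
      using assms that by (intro sum.cong refl, subst sum_zonal_coeff_moment_coeff) auto
    also have "\<dots> = (if j < k then 0 else fact k * pochhammer p k / pochhammer (L + 1) (2 * k) *
        (\<Sum>l\<le>k. ?h l * z ^ l))"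
      unfolding sum_distrib_left using that by (auto intro!: sum.cong)
    finally show ?thesis .
  qed
  have "(\<Sum>i\<le>k. \<Sum>j\<le>k. ?h i * ?h j * (\<Sum>l\<le>min i j. ?m i j l * z ^ l)) =
      (\<Sum>j\<le>k. ?h j * (\<Sum>i\<le>k. ?h i * (\<Sum>l\<le>min i j. ?m i j l * z ^ l)))"
    by (subst sum.swap) (simp add: sum_distrib_left mult_ac)
  also have "\<dots> = (\<Sum>j\<le>k. if j = k then ?h k * (fact k * pochhammer p k /
      pochhammer (L + 1) (2 * k) * (\<Sum>l\<le>k. ?h l * z ^ l)) else 0)"
    by (intro sum.cong refl, subst *) auto
  finally show ?thesis by simp
qed

section \<open>Hermitian scalars\<close>

lemma hconj_0 [simp]: "hconj 0 = (0 :: 'a::hermitian_scalar)"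
  using hconj_add[of 0 "0 :: 'a"] by simp

lemma hconj_diff: "hconj (x - y) = hconj x - hconj (y :: 'a::hermitian_scalar)"
  using hconj_add[of "x - y" y] by (simp add: algebra_simps)

lemma norm_hconj [simp]: "norm (hconj x) = norm (x :: 'a::hermitian_scalar)"
proof (cases "x = 0")
  case False
  have "norm (hconj x) * norm x = (norm x)\<^sup>2"
    using arg_cong[OF hconj_mult_self[of x], of norm] by (simp add: norm_mult)
  then show ?thesis using False by (simp add: power2_eq_square)
qed simp

lemma mult_hconj_self: "x * hconj x = (norm x)\<^sup>2 *\<^sub>R (1 :: 'a::hermitian_scalar)"
proof (cases "x = 0")
  case False
  have "x * hconj x * x = (norm x)\<^sup>2 *\<^sub>R 1 * x"
    using hconj_mult_self[of x] by (simp add: mult.assoc)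
  then show ?thesis using False by (metis mult_right_cancel)
qed simp

text \<open>Multiplied by \<open>hconj x\<close> on the right, both sides become the same real
  multiple of 1, and in a division algebra this factor cancels.\<close>

lemma hconj_hconj [simp]: "hconj (hconj x) = (x :: 'a::hermitian_scalar)"
proof (cases "x = 0")
  case False
  have "hconj (hconj x) * hconj x = x * hconj x"
    unfolding mult_hconj_self hconj_mult_self by simp
  moreover have "hconj x \<noteq> 0" using False norm_hconj[of x] by (metis norm_eq_zero)
  ultimately show ?thesis by (metis mult_right_cancel)
qed simp

lemma continuous_on_hconj [continuous_intros]:
  fixes f :: "'a::topological_space \<Rightarrow> 'b::hermitian_scalar"
  assumes "continuous_on S f"
  shows "continuous_on S (\<lambda>x. hconj (f x))"
proof -
  have "continuous_on UNIV (hconj :: 'b \<Rightarrow> 'b)"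
    unfolding continuous_on_iff dist_norm by (metis hconj_diff norm_hconj)
  then show ?thesis by (rule continuous_on_compose2[OF _ assms]) simp
qed

text \<open>Left multiplication by \<open>a\<close> scales all norms by \<open>norm a\<close>, hence by polarisation it scales
  inner products by \<open>(norm a)\<^sup>2\<close>.\<close>

lemma inner_mult_left_eq: "inner (a * x) y = inner x (hconj a * (y :: 'a::hermitian_scalar))"
proof (cases "a = 0")
  case False
  have polar: "inner (a * u) (a * v) = (norm a)\<^sup>2 * inner u v" for u v :: 'a
    unfolding dot_norm distrib_left[symmetric] norm_mult power_mult_distrib
    by (simp add: right_diff_distrib)
  have "(norm a)\<^sup>2 *\<^sub>R y = a * (hconj a * y)"
    by (simp add: mult_hconj_self flip: mult.assoc)
  then have "(norm a)\<^sup>2 * inner (a * x) y = inner (a * x) (a * (hconj a * y))"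
    by (metis inner_scaleR_right)
  then show ?thesis using False by (simp add: polar)
qed simp

lemma inner_1_1_hermitian [simp]: "inner (1 :: 'a::hermitian_scalar) 1 = 1"
  by (simp flip: power2_norm_eq_inner)

lemma continuous_on_hinner [continuous_intros]:
  assumes "continuous_on S f" "continuous_on S g"
  shows "continuous_on S (\<lambda>x. hinner (f x) (g x))"
  unfolding hinner_def using assms by (intro continuous_intros) auto

lemma borel_measurable_hinner [measurable]:
  fixes f g :: "'a \<Rightarrow> 'b::hermitian_scalar ^ 'n"
  assumes "f \<in> borel_measurable M" "g \<in> borel_measurable M"
  shows "(\<lambda>x. hinner (f x) (g x)) \<in> borel_measurable M"
  by (rule borel_measurable_continuous_Pair[OF assms]) (intro continuous_intros)

lemma hconj_hinner: "hconj (hinner x y) = hinner y (x :: 'k::hermitian_scalar ^ 'n)"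
proof -
  have "hconj (\<Sum>i\<in>A. f i) = (\<Sum>i\<in>A. hconj (f i))" for A and f :: "'n \<Rightarrow> 'k"
    by (induction A rule: infinite_finite_induct) (simp_all add: hconj_add)
  then show ?thesis by (simp add: hinner_def hconj_mult)
qed

lemma norm_hinner_commute: "norm (hinner x y) = norm (hinner y (x :: 'k::hermitian_scalar ^ 'n))"
  by (metis hconj_hinner norm_hconj)

lemma norm_hinner_le: "norm (hinner x y) \<le> norm x * norm (y :: 'k::hermitian_scalar ^ 'n)"
proof -
  have "norm (hinner x y) \<le> (\<Sum>i\<in>UNIV. norm (x $ i) * norm (y $ i))"
    unfolding hinner_def by (rule order_trans[OF norm_sum]) (simp add: norm_mult)
  also have "\<dots> \<le> L2_set (\<lambda>i. norm (x $ i)) UNIV * L2_set (\<lambda>i. norm (y $ i)) UNIV"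
    using L2_set_mult_ineq[of "\<lambda>i. norm (x $ i)" "\<lambda>i. norm (y $ i)" UNIV] by simp
  finally show ?thesis by (simp add: norm_vec_def)
qed

lemma hinner_self: "hinner x x = (norm x)\<^sup>2 *\<^sub>R (1 :: 'k::hermitian_scalar)"
  by (simp add: hinner_def hconj_mult_self norm_vec_def L2_set_def sum_nonneg
      flip: scaleR_left.sum)

text \<open>Additivity alone would give homogeneity only for rational factors. Real factors come
  from \<open>inner_mult_left_eq\<close>, which identifies \<open>hconj x\<close> through its inner
  products.\<close>

lemma hconj_scaleR [simp]: "hconj (r *\<^sub>R x) = r *\<^sub>R hconj (x :: 'a::hermitian_scalar)"
proof -
  have "inner u (hconj (r *\<^sub>R x)) = inner u (r *\<^sub>R hconj x)" for u
    using inner_mult_left_eq[of "r *\<^sub>R x" u 1] inner_mult_left_eq[of x u 1] by simp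
  then show ?thesis using vector_eq_ldot by blast
qed

lemma hinner_scaleR:
  "hinner (a *\<^sub>R x) (b *\<^sub>R y) = (a * b) *\<^sub>R hinner x (y :: 'k::hermitian_scalar ^ 'n)"
  by (simp add: hinner_def scaleR_right.sum mult.commute[of a])

definition rscale :: "'k::hermitian_scalar ^ 'n \<Rightarrow> 'k \<Rightarrow> 'k ^ 'n"
  where "rscale x c = (\<chi> i. x $ i * c)"

lemma norm_rscale [simp]: "norm (rscale x c) = norm x * norm c"
  by (simp add: rscale_def norm_vec_def norm_mult flip: L2_set_left_distrib)

text \<open>The bridge between real and Hermitian products: averaging even powers of the right side
  over unit scalars \<open>c\<close> leaves a multiple of a power of
  \<open>norm (hinner x y)\<close>.\<close>

lemma inner_rscale: "inner (rscale x c) y = inner c (hinner x y)"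
  by (simp add: rscale_def inner_vec_def hinner_def inner_mult_left_eq inner_sum_right)

lemma hinner_rscale: "hinner x (rscale y c) = hinner x y * c"
  by (simp add: rscale_def hinner_def sum_distrib_right mult.assoc)

section \<open>Random unit vectors\<close>

text \<open>Among the i + j factors choose the j + l that do not contribute the constant a, and
  among these the j - l that contribute the quadratic term; the other 2l are linear, and the degree
  is 2l + 2(j - l) = 2j.\<close>

lemma coeff_quadratic_power:
  "coeff ([:a, b, c:] ^ (i + j)) (2 * j) = (\<Sum>l\<le>min i j. real ((i + j) choose (j + l)) *
    real ((j + l) choose (j - l)) * b ^ (2 * l) * a ^ (i - l) * (c :: real) ^ (j - l))"
proof -
  let ?n = "i + j"
  define g where "g r = real (?n choose r) * a ^ (?n - r) *
    (if 2 * j < r then 0 else coeff ([:b, c:] ^ r) (2 * j - r))" for r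
  define q where "q = [:b, c:]"
  have "[:a, b, c:] = monom 1 1 * q + [:a:]"
    by (simp add: monom_altdef q_def)
  then have "[:a, b, c:] ^ ?n = (\<Sum>r\<le>?n. of_nat (?n choose r) * (monom 1 1 * q) ^ r * [:a:] ^ (?n - r))"
    by (simp only: binomial_ring)
  also have "\<dots> = (\<Sum>r\<le>?n. smult (real (?n choose r) * a ^ (?n - r)) (monom 1 r * q ^ r))"
    by (intro sum.cong) (simp_all add: power_mult_distrib monom_power poly_const_pow of_nat_poly mult_ac)
  finally have "coeff ([:a, b, c:] ^ ?n) (2 * j) = (\<Sum>r\<le>?n. g r)"
    by (simp add: coeff_sum coeff_monom_mult g_def q_def cong: if_cong)
  \<comment> \<open>A summand with \<open>r\<close> nonconstant factors contains only powers from r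
    to 2r, so the coefficient at 2j forces r = j + l with l at most j; l is at most i because there
    are only i + j factors.\<close>
  also have "\<dots> = (\<Sum>r\<in>(+) j ` {..min i j}. g r)"
  proof (rule sum.mono_neutral_right)
    show "\<forall>r\<in>{..?n} - (+) j ` {..min i j}. g r = 0"
    proof
      fix r assume r: "r \<in> {..?n} - (+) j ` {..min i j}"
      have "r \<in> (+) j ` {..min i j}" if "j \<le> r" "r \<le> 2 * j"
        using that r by (intro image_eqI[of _ _ "r - j"]) auto
      with r have "r < j \<or> 2 * j < r" by force
      then show "g r = 0"
      proof
        assume "r < j"
        then have "r < 2 * j - r" by simp
        moreover have "degree ([:b, c:] ^ r) \<le> r"
          using degree_power_le[of "[:b, c:]" r] by (cases "c = 0") auto
        ultimately show ?thesis by (simp add: g_def coeff_eq_0)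
      qed (simp add: g_def)
    qed
  qed auto
  also have "\<dots> = (\<Sum>l\<le>min i j. g (j + l))"
    by (subst sum.reindex) auto
  also have "\<dots> = (\<Sum>l\<le>min i j. real ((i + j) choose (j + l)) *
      real ((j + l) choose (j - l)) * b ^ (2 * l) * a ^ (i - l) * c ^ (j - l))"
  proof (intro sum.cong refl)
    fix l assume "l \<in> {..min i j}"
    then have "2 * j - (j + l) = j - l" "j + l - (j - l) = 2 * l" "j - l \<le> j + l"
      "\<not> 2 * j < j + l" "i + j - (j + l) = i - l" by auto
    then show "g (j + l) = real ((i + j) choose (j + l)) *
      real ((j + l) choose (j - l)) * b ^ (2 * l) * a ^ (i - l) * c ^ (j - l)"
      by (simp add: g_def coeff_linear_poly_power mult_2)
  qed
  finally show ?thesis .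
qed

text \<open>The duplication formula \<open>fact_double\<close> rewrites (2m)! by m! and
  \<open>pochhammer (1 / 2) m\<close>; this absorbs the powers of 2 and the binomial coefficients
  left by polarisation.\<close>

lemma moment_coeff_half:
  assumes "l \<le> i" "l \<le> j" "n > 0"
  shows "pochhammer (1 / 2) (i + j) / pochhammer n (i + j) *
      (real ((i + j) choose (j + l)) * real ((j + l) choose (j - l)) * 2 ^ (2 * l)) /
      real ((2 * (i + j)) choose (2 * j)) = moment_coeff (1 / 2) n i j l"
proof -
  have half: "pochhammer (1 / 2 :: real) m > 0" for m by (rule pochhammer_pos) simp
  have 1: "real ((i + j) choose (j + l)) = fact (i + j) / (fact (j + l) * fact (i - l))"
    using assms by (subst binomial_fact) auto
  have 2: "real ((j + l) choose (j - l)) = fact (j + l) / (fact (j - l) * fact (2 * l))"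
    using assms by (subst binomial_fact) (auto simp: mult_2)
  have 3: "real ((2 * (i + j)) choose (2 * j)) = fact (2 * (i + j)) / (fact (2 * j) * fact (2 * i))"
    using assms by (subst binomial_fact) auto
  show ?thesis
    unfolding moment_coeff_def 1 2 3 fact_double using half[of i] half[of j] half[of l] half[of "i + j"]
    by (simp add: field_simps power_add)
qed

text \<open>A finite measure of positive mass, not a probability measure, because the Gaussian
  construction below reweights by a power of the norm. The mass is carried along as a
  factor.\<close>

locale random_unit_vector = finite_measure M for M :: "'w measure" +
  fixes U :: "'w \<Rightarrow> 'a::euclidean_space"
  assumes U_measurable [measurable]: "U \<in> borel_measurable M"
    and norm_U [simp]: "norm (U \<omega>) = 1"
    and mass_pos: "measure M (space M) > 0"
begin

lemma abs_inner_U_le: "\<bar>inner x (U \<omega>)\<bar> \<le> norm x"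
  using Cauchy_Schwarz_ineq2[of x "U \<omega>"] by simp

lemma integrable_inner_U: "integrable M (\<lambda>\<omega>. inner x (U \<omega>) ^ i * inner y (U \<omega>) ^ j)"
proof (rule integrable_const_bound[where B = "norm x ^ i * norm y ^ j"])
  show "AE \<omega> in M. norm (inner x (U \<omega>) ^ i * inner y (U \<omega>) ^ j) \<le> norm x ^ i * norm y ^ j"
    by (auto simp: abs_mult power_abs intro!: mult_mono power_mono abs_inner_U_le)
qed simp

text \<open>Rotational symmetry enters only through the even moments of the one-dimensional marginals.\<close>

definition even_moment :: "nat \<Rightarrow> real \<Rightarrow> bool"
  where "even_moment n C \<longleftrightarrow> (\<forall>w. (\<integral>\<omega>. inner w (U \<omega>) ^ (2 * n) \<partial>M) = C * norm w ^ (2 * n))"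

text \<open>Compare the coefficients of \<open>t\<close> in the moment of \<open>x + t *\<^sub>R y\<close>.\<close>

lemma mixed_moment_polarised:
  assumes "even_moment (i + j) C"
  shows "real ((2 * (i + j)) choose (2 * j)) *
      (\<integral>\<omega>. inner x (U \<omega>) ^ (2 * i) * inner y (U \<omega>) ^ (2 * j) \<partial>M) =
    C * (\<Sum>l\<le>min i j. real ((i + j) choose (j + l)) * real ((j + l) choose (j - l)) *
      (2 * inner x y) ^ (2 * l) * ((norm x)\<^sup>2) ^ (i - l) * ((norm y)\<^sup>2) ^ (j - l))"
proof -
  let ?n = "i + j"
  define m where "m k = (\<integral>\<omega>. inner x (U \<omega>) ^ (2 * ?n - k) * inner y (U \<omega>) ^ k \<partial>M)" for k
  define p where "p = (\<Sum>k\<le>2 * ?n. monom (real ((2 * ?n) choose k) * m k) k)"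
  define q where "q = smult C ([:(norm x)\<^sup>2, 2 * inner x y, (norm y)\<^sup>2:] ^ ?n)"
  have "poly p t = poly q t" for t
  proof -
    have "C * norm (t *\<^sub>R y + x) ^ (2 * ?n) = (\<integral>\<omega>. (t * inner y (U \<omega>) + inner x (U \<omega>)) ^ (2 * ?n) \<partial>M)"
      using assms[unfolded even_moment_def, rule_format, of "t *\<^sub>R y + x"]
      by (simp add: inner_add_left)
    also have "\<dots> = (\<integral>\<omega>. (\<Sum>k\<le>2 * ?n. real ((2 * ?n) choose k) * t ^ k *
        (inner x (U \<omega>) ^ (2 * ?n - k) * inner y (U \<omega>) ^ k)) \<partial>M)"
      by (simp only: binomial_ring power_mult_distrib mult_ac)
    also have "\<dots> = (\<Sum>k\<le>2 * ?n. real ((2 * ?n) choose k) * t ^ k * m k)"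
      unfolding m_def by (subst Bochner_Integration.integral_sum) (auto intro!: integrable_inner_U)
    finally have "C * (norm (t *\<^sub>R y + x))\<^sup>2 ^ ?n = poly p t"
      unfolding power_mult by (simp add: p_def poly_sum poly_monom mult_ac)
    moreover have "(norm (t *\<^sub>R y + x))\<^sup>2 = (norm x)\<^sup>2 + t * (2 * inner x y + t * (norm y)\<^sup>2)"
      by (simp add: power2_norm_eq_inner inner_add_left inner_add_right inner_commute algebra_simps)
    ultimately show ?thesis by (simp add: q_def)
  qed
  then have "coeff p (2 * j) = coeff q (2 * j)"
    by (metis poly_eq_poly_eq_iff ext)
  moreover have "coeff p (2 * j) = real ((2 * ?n) choose (2 * j)) * m (2 * j)"
    by (simp add: p_def coeff_sum if_distrib cong: if_cong)
  moreover have "2 * ?n - 2 * j = 2 * i" by simp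
  ultimately show ?thesis
    unfolding q_def coeff_smult coeff_quadratic_power m_def by (simp only:)
qed

text \<open>Sum the mixed moment with j = 1 over the vectors of an orthonormal basis. Since U has
  norm 1, the squared coordinates add up to 1 and the next lower moment of x remains.\<close>

lemma even_moment_descend:
  assumes "even_moment (Suc n) C"
  shows "even_moment n (C * (real DIM('a) + 2 * real n) / (2 * real n + 1))"
  unfolding even_moment_def
proof
  fix x :: 'a
  let ?I = "\<lambda>b. \<integral>\<omega>. inner x (U \<omega>) ^ (2 * n) * inner b (U \<omega>) ^ (2 * 1) \<partial>M"
  have b: "real ((2 * (n + 1)) choose 2) * ?I b =
      C * (real (n + 1) * norm x ^ (2 * n) +
        real ((n + 1) choose 2) * (4 * norm x ^ (2 * (n - 1)) * (inner x b)\<^sup>2))"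
    if "b \<in> Basis" for b
  \<comment> \<open>For \<open>n = 0\<close> the sum over \<open>l\<close> consists of its first
    term alone. The second term of the claim vanishes then because \<open>1 choose 2\<close> is 0,
    so the truncated exponent \<open>n - 1\<close> does no harm.\<close>
  proof (cases n)
    case 0
    then show ?thesis using mixed_moment_polarised[of n 1 C x b] assms that by simp
  next
    case (Suc k)
    then have "{..min n 1} = {0, 1}" by auto
    then show ?thesis using mixed_moment_polarised[of n 1 C x b] assms that
      by (simp add: power_mult_distrib power_add mult_ac numeral_2_eq_2 del: binomial_Suc_Suc)
  qed
  have "(\<Sum>b\<in>Basis. ?I b) = (\<integral>\<omega>. (\<Sum>b\<in>Basis. inner x (U \<omega>) ^ (2 * n) * inner b (U \<omega>) ^ (2 * 1)) \<partial>M)"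
    by (subst Bochner_Integration.integral_sum) (auto intro!: integrable_inner_U)
  also have "\<dots> = (\<integral>\<omega>. inner x (U \<omega>) ^ (2 * n) \<partial>M)"
  proof -
    have "(\<Sum>b\<in>Basis. (inner b (U \<omega>))\<^sup>2) = 1" for \<omega>
      using norm_eq_sqrt_inner[of "U \<omega>"] euclidean_inner[of "U \<omega>" "U \<omega>"]
      by (simp add: inner_commute power2_eq_square)
    then show ?thesis by (simp flip: sum_distrib_left)
  qed
  finally have sum_I: "(\<Sum>b\<in>Basis. ?I b) = (\<integral>\<omega>. inner x (U \<omega>) ^ (2 * n) \<partial>M)" .
  have c1: "real ((2 * (n + 1)) choose 2) = real (n + 1) * (2 * real n + 1)"
    by (simp add: choose_two real_of_nat_div algebra_simps)
  have c2: "real ((n + 1) choose 2) = real (n + 1) * real n / 2"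
    by (simp add: choose_two real_of_nat_div algebra_simps)
  have "real (n + 1) * (2 * real n + 1) * (\<integral>\<omega>. inner x (U \<omega>) ^ (2 * n) \<partial>M) =
      (\<Sum>b\<in>Basis. C * (real (n + 1) * norm x ^ (2 * n) +
        real ((n + 1) choose 2) * (4 * norm x ^ (2 * (n - 1)) * (inner x b)\<^sup>2)))"
    unfolding sum_I[symmetric] c1[symmetric] sum_distrib_left by (intro sum.cong refl b)
  also have "\<dots> = C * (real (n + 1) * norm x ^ (2 * n) * real DIM('a) +
        real ((n + 1) choose 2) * (4 * norm x ^ (2 * (n - 1)) * (norm x)\<^sup>2))"
  proof -
    have "(norm x)\<^sup>2 = (\<Sum>b\<in>Basis. (inner x b)\<^sup>2)"
      unfolding power2_norm_eq_inner using euclidean_inner[of x x] by (simp add: power2_eq_square)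
    then show ?thesis by (simp add: sum.distrib flip: sum_distrib_left)
  qed
  also have "\<dots> = real (n + 1) * (C * (real DIM('a) + 2 * real n) * norm x ^ (2 * n))"
    unfolding c2 by (cases n) (simp_all add: algebra_simps power2_eq_square)
  finally have "(2 * real n + 1) * (\<integral>\<omega>. inner x (U \<omega>) ^ (2 * n) \<partial>M) =
      C * (real DIM('a) + 2 * real n) * norm x ^ (2 * n)"
    by (simp add: mult.assoc)
  then show "(\<integral>\<omega>. inner x (U \<omega>) ^ (2 * n) \<partial>M) =
      C * (real DIM('a) + 2 * real n) / (2 * real n + 1) * norm x ^ (2 * n)"
    by (simp add: field_simps)
qed

text \<open>Descending to order 0, where the moment is the total mass, determines the constant; each
  step of the descent contributes one factor of both Pochhammer symbols.\<close>

lemma even_moment_unique: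
  assumes "even_moment n C"
  shows "C = measure M (space M) * pochhammer (1 / 2) n / pochhammer (real DIM('a) / 2) n"
  using assms
proof (induction n arbitrary: C)
  case 0
  then show ?case by (simp add: even_moment_def)
next
  case (Suc n)
  have "pochhammer (real DIM('a) / 2) n > 0" by (rule pochhammer_pos) simp
  moreover have "real DIM('a) + real n * 2 > 0" by (simp add: add_pos_nonneg)
  ultimately show ?case
    using Suc.IH[OF even_moment_descend[OF Suc.prems]]
    by (simp add: pochhammer_Suc divide_simps) (simp add: algebra_simps)
qed

end

section \<open>Gaussian construction of a random unit vector\<close>

lemma sum_power_le:
  fixes a :: "'i \<Rightarrow> real"
  assumes "finite I" "I \<noteq> {}" "\<And>i. i \<in> I \<Longrightarrow> a i \<ge> 0"
  shows "(\<Sum>i\<in>I. a i) ^ n \<le> real (card I) ^ n * (\<Sum>i\<in>I. a i ^ n)"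
proof -
  from assms obtain m where m: "m \<in> I" "\<And>i. i \<in> I \<Longrightarrow> a i \<le> a m"
    using finite_imageI[OF assms(1), of a] Max_in[of "a ` I"] Max_ge[of "a ` I"]
    by (metis (no_types, lifting) image_iff image_is_empty)
  have "(\<Sum>i\<in>I. a i) ^ n \<le> (real (card I) * a m) ^ n"
    using m assms by (intro power_mono sum_nonneg sum_bounded_above) auto
  also have "\<dots> \<le> real (card I) ^ n * (\<Sum>i\<in>I. a i ^ n)"
    unfolding power_mult_distrib using m assms
    by (intro mult_left_mono member_le_sum) auto
  finally show ?thesis .
qed

text \<open>Sums of independent normal variables are normal, so that the standard Gaussian vector has
  rotationally symmetric marginals; weighting it by a power of its norm and normalising makes one
  given moment of the direction symmetric.\<close>

lemma gaussian_marginal: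
  fixes w :: "'a::euclidean_space"
  assumes "w \<noteq> 0"
  shows "distributed (\<Pi>\<^sub>M b\<in>Basis. density lborel std_normal_density) lborel
    (\<lambda>\<omega>. \<Sum>b\<in>Basis. inner w b * \<omega> b) (normal_density 0 (norm w))"
proof -
  let ?N = "density lborel std_normal_density" let ?M = "\<Pi>\<^sub>M b\<in>(Basis::'a set). ?N"
  have N: "prob_space ?N" by (rule prob_space_normal_density) simp
  interpret prob_space ?M by (intro prob_space_PiM N)
  have meas [measurable]: "(\<lambda>\<omega>. \<omega> b) \<in> borel_measurable ?M" if "b \<in> Basis" for b
    using measurable_component_singleton[OF that, of "\<lambda>_. ?N"] by simp
  have distr: "distr ?M borel (\<lambda>\<omega>. \<omega> b) = ?N" if "b \<in> Basis" for b
    using distr_PiM_component[of Basis "\<lambda>_. ?N" b] N that by (simp cong: distr_cong)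
  have indep: "indep_vars (\<lambda>_. borel) (\<lambda>b \<omega>. \<omega> b) Basis"
  proof (subst indep_vars_iff_distr_eq_PiM')
    have "distr ?M (\<Pi>\<^sub>M b\<in>Basis. borel) (\<lambda>\<omega>. \<lambda>b\<in>Basis. \<omega> b) = distr ?M ?M (\<lambda>\<omega>. \<omega>)"
      by (intro distr_cong sets_PiM_cong) (auto simp: space_PiM PiE_def extensional_restrict)
    also have "\<dots> = (\<Pi>\<^sub>M b\<in>Basis. distr ?M borel (\<lambda>\<omega>. \<omega> b))"
      by (simp add: distr_id2 distr cong: PiM_cong)
    finally show "distr ?M (\<Pi>\<^sub>M b\<in>Basis. borel) (\<lambda>\<omega>. \<lambda>b\<in>Basis. \<omega> b) =
      (\<Pi>\<^sub>M b\<in>Basis. distr ?M borel (\<lambda>\<omega>. \<omega> b))" .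
  qed auto
  \<comment> \<open>Summation of independent normal variables requires positive standard deviations,
    so vanishing coordinates of \<open>w\<close> are dropped; \<open>w \<noteq> 0\<close> keeps the
    index set nonempty.\<close>
  define I where "I = {b\<in>Basis. inner w b \<noteq> 0}"
  have I: "finite I" "I \<noteq> {}" "I \<subseteq> Basis"
    using assms euclidean_all_zero_iff[of w] by (auto simp: I_def)
  have "distributed ?M lborel (\<lambda>\<omega>. \<Sum>b\<in>I. inner w b * \<omega> b)
      (normal_density (\<Sum>b\<in>I. 0) (sqrt (\<Sum>b\<in>I. \<bar>inner w b\<bar>\<^sup>2)))"
  proof (rule sum_indep_normal)
    show "indep_vars (\<lambda>_. borel) (\<lambda>b \<omega>. inner w b * \<omega> b) I"
      using indep_vars_compose2[OF indep_vars_subset[OF indep I(3)], of "\<lambda>b x. inner w b * x" "\<lambda>_. borel"]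
      by simp
    fix b assume b: "b \<in> I"
    then show "0 < \<bar>inner w b\<bar>" by (simp add: I_def)
    have "b \<in> Basis" using b I by auto
    have "distributed ?M lborel (\<lambda>\<omega>. \<omega> b) std_normal_density"
      unfolding distributed_def using distr[OF \<open>b \<in> Basis\<close>] meas[OF \<open>b \<in> Basis\<close>]
      by (simp cong: distr_cong)
    from normal_density_affine[OF this, of "inner w b" 0] b
    show "distributed ?M lborel (\<lambda>\<omega>. inner w b * \<omega> b) (normal_density 0 \<bar>inner w b\<bar>)"
      by (simp add: I_def)
  qed (use I in auto)
  moreover have "(\<Sum>b\<in>I. inner w b * \<omega> b) = (\<Sum>b\<in>Basis. inner w b * \<omega> b)" for \<omega>
    by (rule sum.mono_neutral_left) (auto simp: I_def)
  moreover have "(\<Sum>b\<in>I. \<bar>inner w b\<bar>\<^sup>2) = (\<Sum>b\<in>Basis. \<bar>inner w b\<bar>\<^sup>2)"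
    by (rule sum.mono_neutral_left) (auto simp: I_def)
  moreover have "sqrt (\<Sum>b\<in>Basis. \<bar>inner w b\<bar>\<^sup>2) = norm w"
    using euclidean_inner[of w w] by (simp add: norm_eq_sqrt_inner power2_eq_square)
  ultimately show ?thesis by simp
qed

lemma ex_even_moment:
  obtains M :: "('a::euclidean_space \<Rightarrow> real) measure" and U :: "('a \<Rightarrow> real) \<Rightarrow> 'a" and C
  where "random_unit_vector M U" "random_unit_vector.even_moment M U n C"
proof -
  let ?N = "density lborel std_normal_density" let ?M = "\<Pi>\<^sub>M b\<in>(Basis::'a set). ?N"
  interpret prob_space ?M by (intro prob_space_PiM prob_space_normal_density) simp
  have meas [measurable]: "(\<lambda>\<omega>. \<omega> b) \<in> borel_measurable ?M" if "b \<in> Basis" for b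
    using measurable_component_singleton[OF that, of "\<lambda>_. ?N"] by simp
  define X :: "('a \<Rightarrow> real) \<Rightarrow> 'a" where "X \<omega> = (\<Sum>b\<in>Basis. \<omega> b *\<^sub>R b)" for \<omega>
  have X [measurable]: "X \<in> borel_measurable ?M" unfolding X_def by measurable
  have inner_X: "inner w (X \<omega>) = (\<Sum>b\<in>Basis. inner w b * \<omega> b)" for w \<omega>
    by (simp add: X_def inner_sum_right mult.commute)
  \<comment> \<open>The moment of order \<open>2 * n\<close> of a standard normal variable, (2n -
    1)!!.\<close>
  define K :: real where "K = fact (2 * n) / (2 ^ n * fact n)"
  have moment: "integrable ?M (\<lambda>\<omega>. inner w (X \<omega>) ^ (2 * n))"
    "(\<integral>\<omega>. inner w (X \<omega>) ^ (2 * n) \<partial>?M) = K * norm w ^ (2 * n)" for w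
  proof -
    have "integrable ?M (\<lambda>\<omega>. inner w (X \<omega>) ^ (2 * n)) \<and>
      (\<integral>\<omega>. inner w (X \<omega>) ^ (2 * n) \<partial>?M) = K * norm w ^ (2 * n)"
    proof (cases "w = 0")
      case True
      then show ?thesis by (cases "n = 0") (simp_all add: K_def prob_space power_0_left)
    next
      case False
      note D = gaussian_marginal[OF False, folded inner_X]
      have int: "integrable ?M (\<lambda>\<omega>. inner w (X \<omega>) ^ (2 * n))"
        using distributed_integrable[OF D, of "\<lambda>x. x ^ (2 * n)"]
          integrable_normal_moment[of "norm w" 0 "2 * n"] False by simp
      have "(\<integral>\<omega>. inner w (X \<omega>) ^ (2 * n) \<partial>?M) = fact (2 * n) / ((2 / (norm w)\<^sup>2) ^ n * fact n)"
        using distributed_integral[OF D, of "\<lambda>x. x ^ (2 * n)"]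
          integral_normal_moment_even[of "norm w" 0 n] False by simp
      also have "\<dots> = K * norm w ^ (2 * n)"
        using False by (simp add: K_def power_mult power_divide)
      finally show ?thesis using int by blast
    qed
    then show "integrable ?M (\<lambda>\<omega>. inner w (X \<omega>) ^ (2 * n))"
      "(\<integral>\<omega>. inner w (X \<omega>) ^ (2 * n) \<partial>?M) = K * norm w ^ (2 * n)" by auto
  qed
  \<comment> \<open>The crude power-mean bound \<open>sum_power_le\<close> dominates the power of
    the norm by moments of the coordinates. This makes the reweighted measure finite.\<close>
  have int: "integrable ?M (\<lambda>\<omega>. norm (X \<omega>) ^ (2 * n))"
  proof (rule Bochner_Integration.integrable_bound)
    show "integrable ?M (\<lambda>\<omega>. real DIM('a) ^ n * (\<Sum>b\<in>Basis. inner b (X \<omega>) ^ (2 * n)))"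
      by (intro integrable_mult_right Bochner_Integration.integrable_sum moment)
    have "norm (X \<omega>) ^ (2 * n) \<le> real DIM('a) ^ n * (\<Sum>b\<in>Basis. inner b (X \<omega>) ^ (2 * n))" for \<omega>
    proof -
      have "(norm (X \<omega>))\<^sup>2 = (\<Sum>b\<in>Basis. (inner b (X \<omega>))\<^sup>2)"
        using euclidean_inner[of "X \<omega>" "X \<omega>"]
        unfolding power2_norm_eq_inner by (simp add: inner_commute power2_eq_square)
      then show ?thesis using sum_power_le[of Basis "\<lambda>b. (inner b (X \<omega>))\<^sup>2" n]
        by (simp add: power_mult)
    qed
    then show "AE \<omega> in ?M. norm (norm (X \<omega>) ^ (2 * n)) \<le>
        norm (real DIM('a) ^ n * (\<Sum>b\<in>Basis. inner b (X \<omega>) ^ (2 * n)))"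
      by (intro AE_I2) (smt (verit) real_norm_def norm_ge_zero zero_le_power)
  qed simp
  define b0 :: 'a where "b0 = (SOME b. b \<in> Basis)"
  have b0: "norm b0 = 1" by (simp add: b0_def some_in_eq)
  \<comment> \<open>The default \<open>b0\<close> makes \<open>U\<close> a unit vector even where
    \<open>X\<close> is 0. There both sides of \<open>scale\<close> below are 0 for n > 0, and both
    are 1 for n = 0.\<close>
  define U where "U \<omega> = (if X \<omega> = 0 then b0 else sgn (X \<omega>))" for \<omega>
  let ?D = "density ?M (\<lambda>\<omega>. norm (X \<omega>) ^ (2 * n))"
  have U [measurable]: "U \<in> borel_measurable ?M"
    unfolding U_def sgn_div_norm by measurable
  have m: "(\<integral>\<omega>. inner w (U \<omega>) ^ (2 * n) \<partial>?D) = K * norm w ^ (2 * n)" for w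
  proof -
    have scale: "norm (X \<omega>) ^ (2 * n) * inner w (U \<omega>) ^ (2 * n) = inner w (X \<omega>) ^ (2 * n)" for \<omega>
    proof (cases "X \<omega> = 0")
      case False
      then have "norm (X \<omega>) * inner w (U \<omega>) = inner w (X \<omega>)"
        by (simp add: U_def sgn_div_norm)
      then show ?thesis by (metis power_mult_distrib)
    qed (simp add: power_0_left)
    have "(\<integral>\<omega>. inner w (U \<omega>) ^ (2 * n) \<partial>?D) = (\<integral>\<omega>. norm (X \<omega>) ^ (2 * n) *\<^sub>R inner w (U \<omega>) ^ (2 * n) \<partial>?M)"
      by (rule integral_density) auto
    also have "\<dots> = (\<integral>\<omega>. inner w (X \<omega>) ^ (2 * n) \<partial>?M)"
      by (simp only: real_scaleR_def scale)
    finally show ?thesis using moment by simp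
  qed
  have emeasure: "emeasure ?D (space ?D) = ennreal (\<integral>\<omega>. norm (X \<omega>) ^ (2 * n) \<partial>?M)"
    using int by (simp add: emeasure_density nn_integral_eq_integral cong: nn_integral_cong_simp)
  interpret D: finite_measure ?D
    by standard (use emeasure in simp)
  have "random_unit_vector ?D U"
  proof
    show "measure ?D (space ?D) > 0"
    proof (rule ccontr)
      assume "\<not> measure ?D (space ?D) > 0"
      then have "emeasure ?D (space ?D) = 0"
        by (simp add: D.emeasure_eq_measure zero_less_measure_iff)
      then have "AE \<omega> in ?D. False" by (intro AE_I[of _ _ "space ?D"]) auto
      then have "(\<integral>\<omega>. inner b0 (U \<omega>) ^ (2 * n) \<partial>?D) = (\<integral>\<omega>. 0 \<partial>?D)"
        by (intro integral_cong_AE) auto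
      then show False using m[of b0] b0 by (simp add: K_def)
    qed
  qed (auto simp: U_def norm_sgn b0)
  then show thesis
    using that[of ?D U K] m by (simp add: random_unit_vector.even_moment_def)
qed

section \<open>Mixed moments of a random unit vector\<close>

context random_unit_vector
begin

lemma even_moment_mono:
  assumes "even_moment n C" "i \<le> n"
  shows "\<exists>C. even_moment i C"
  using assms(2,1) by (induction n arbitrary: C rule: dec_induct) (blast intro: even_moment_descend)+

lemma even_moment_eq:
  assumes "even_moment n C" "i \<le> n"
  shows "(\<integral>\<omega>. inner w (U \<omega>) ^ (2 * i) \<partial>M) =
    measure M (space M) * pochhammer (1 / 2) i / pochhammer (real DIM('a) / 2) i * norm w ^ (2 * i)"
  using even_moment_mono[OF assms] even_moment_unique unfolding even_moment_def by blast

lemma mixed_moment: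
  assumes "even_moment n C" "i + j \<le> n" "norm x = 1" "norm y = 1"
  shows "(\<integral>\<omega>. inner x (U \<omega>) ^ (2 * i) * inner y (U \<omega>) ^ (2 * j) \<partial>M) =
    measure M (space M) *
      (\<Sum>l\<le>min i j. moment_coeff (1 / 2) (real DIM('a) / 2) i j l * inner x y ^ (2 * l))"
proof -
  let ?c = "real ((2 * (i + j)) choose (2 * j))"
  obtain D where D: "even_moment (i + j) D" using even_moment_mono[OF assms(1,2)] by blast
  have "?c > 0" by simp
  then have "(\<integral>\<omega>. inner x (U \<omega>) ^ (2 * i) * inner y (U \<omega>) ^ (2 * j) \<partial>M) =
      D * (\<Sum>l\<le>min i j. real ((i + j) choose (j + l)) * real ((j + l) choose (j - l)) *
      (2 * inner x y) ^ (2 * l)) / ?c"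
    using mixed_moment_polarised[OF D, of x y] assms by (simp add: field_simps)
  also have "\<dots> = measure M (space M) * (\<Sum>l\<le>min i j.
      pochhammer (1 / 2) (i + j) / pochhammer (real DIM('a) / 2) (i + j) *
      (real ((i + j) choose (j + l)) * real ((j + l) choose (j - l)) * 2 ^ (2 * l)) / ?c *
      inner x y ^ (2 * l))"
    unfolding even_moment_unique[OF D] sum_distrib_left sum_divide_distrib
    by (intro sum.cong) (simp_all add: power_mult_distrib)
  also have "\<dots> = measure M (space M) *
      (\<Sum>l\<le>min i j. moment_coeff (1 / 2) (real DIM('a) / 2) i j l * inner x y ^ (2 * l))"
    by (intro arg_cong2[where f = "(*)"] sum.cong refl moment_coeff_half) auto
  finally show ?thesis .
qed

end

section \<open>Convolution of zonal functions\<close>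

text \<open>\<open>r i\<close> is the factor that averaging over unit scalars of real dimension 2p
  attaches to a power of order 2i. The two given powers are divided by their factors and the
  resulting power is multiplied by its own, which turns 1/2 into \<open>p\<close>.\<close>

lemma moment_coeff_ratio:
  assumes "p > 0"
  defines "r \<equiv> \<lambda>i. pochhammer (1 / 2) i / pochhammer p i"
  shows "moment_coeff (1 / 2) n i j l * r l / (r i * r j) = moment_coeff p n i j l"
proof -
  have "pochhammer (1 / 2 :: real) i > 0" "pochhammer p i > 0" for i
    using assms by (auto intro: pochhammer_pos)
  then have "pochhammer (1 / 2 :: real) i \<noteq> 0" "pochhammer p i \<noteq> 0" for i
    by (metis less_irrefl)+
  then show ?thesis by (simp add: moment_coeff_def r_def field_simps)
qed

text \<open>The functions \<open>norm (hinner u _) ^ (2 * i)\<close> are averages of real ridge functions over the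
  unit scalars, so that the mixed moments over \<open>K\<close> reduce to the real ones.\<close>

locale random_unit_scalar_and_vector =
  S: random_unit_vector N V + random_unit_vector M U
  for N :: "'v measure" and V :: "'v \<Rightarrow> 'k::hermitian_scalar"
    and M :: "'w measure" and U :: "'w \<Rightarrow> 'k ^ 'n" +
  fixes n :: nat and C D :: real
  assumes moment_V: "S.even_moment n C" and moment_U: "even_moment n D"
begin

abbreviation mass :: real where "mass \<equiv> measure M (space M)"

definition ratio :: "nat \<Rightarrow> real"
  where "ratio i = pochhammer (1 / 2) i / pochhammer (real DIM('k) / 2) i"

lemma ratio_pos: "ratio i > 0"
  by (auto simp: ratio_def intro!: divide_pos_pos pochhammer_pos)

lemma norm_hinner_U_le: "norm (hinner u (U \<omega>)) \<le> norm u"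
  using norm_hinner_le[of u "U \<omega>"] by simp

lemma integral_inner_V:
  assumes "i \<le> n"
  shows "(\<integral>\<xi>. inner (V \<xi>) a ^ (2 * i) \<partial>N) = measure N (space N) * ratio i * norm a ^ (2 * i)"
  using S.even_moment_eq[OF moment_V assms, of a] by (simp add: ratio_def inner_commute)

text \<open>By Fubini the scalar is averaged first, after \<open>inner_rscale\<close> has turned the
  ridge function into a power of its inner product with \<open>hinner u (U \<omega>)\<close>. The
  bounded function \<open>f\<close> stands for the other factor, so that the two factors of a mixed
  moment can be converted one at a time.\<close>

lemma average_inner_rscale:
  assumes [measurable]: "f \<in> borel_measurable M" and f: "\<And>\<omega>. \<bar>f \<omega>\<bar> \<le> B" and "i \<le> n"
  shows "(\<integral>\<xi>. (\<integral>\<omega>. f \<omega> * inner (rscale u (V \<xi>)) (U \<omega>) ^ (2 * i) \<partial>M) \<partial>N) =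
    measure N (space N) * ratio i * (\<integral>\<omega>. f \<omega> * norm (hinner u (U \<omega>)) ^ (2 * i) \<partial>M)"
proof -
  interpret P: pair_sigma_finite M N ..
  interpret Q: finite_measure "M \<Otimes>\<^sub>M N"
    by (intro finite_measure_pair_measure) unfold_locales
  let ?g = "\<lambda>\<omega> \<xi>. f \<omega> * inner (V \<xi>) (hinner u (U \<omega>)) ^ (2 * i)"
  have "\<bar>?g \<omega> \<xi>\<bar> \<le> B * norm u ^ (2 * i)" for \<omega> \<xi>
  proof -
    have "\<bar>inner (V \<xi>) (hinner u (U \<omega>))\<bar> \<le> norm u"
      using S.abs_inner_U_le[of "hinner u (U \<omega>)" \<xi>] norm_hinner_U_le[of u \<omega>]
      by (simp add: inner_commute)
    moreover have "0 \<le> B" using f[of undefined] by simp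
    ultimately show ?thesis
      unfolding abs_mult power_abs by (intro mult_mono power_mono f) auto
  qed
  then have "integrable (M \<Otimes>\<^sub>M N) (case_prod ?g)"
    by (intro Q.integrable_const_bound[where B = "B * norm u ^ (2 * i)"]) auto
  from P.Fubini_integral[OF this] show ?thesis
    by (simp add: inner_rscale integral_inner_V[OF assms(3)] mult.assoc
        mult.left_commute[of "f _"])
qed

lemma integrable_hinner_U: "integrable M (\<lambda>\<omega>. norm (hinner u (U \<omega>)) ^ i * norm (hinner v (U \<omega>)) ^ j)"
  by (rule integrable_const_bound[where B = "norm u ^ i * norm v ^ j"])
    (auto intro!: AE_I2 mult_mono power_mono norm_hinner_U_le)

text \<open>Only the factor of \<open>u\<close> is averaged. On the right the scalar meets
  \<open>y\<close> as well, in \<open>inner (V \<xi>) (hinner u y)\<close>, and averaging that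
  produces \<open>ratio l\<close>.\<close>

lemma mixed_moment_real_hermitian:
  assumes "i + j \<le> n" "norm u = 1" "norm y = 1"
  shows "(\<integral>\<omega>. inner y (U \<omega>) ^ (2 * j) * norm (hinner u (U \<omega>)) ^ (2 * i) \<partial>M) =
    mass * (\<Sum>l\<le>min i j. moment_coeff (1 / 2) (real DIM('k ^ 'n) / 2) i j l *
      (ratio l / ratio i) * norm (hinner u y) ^ (2 * l))"
proof -
  let ?m = "measure N (space N)" and ?c = "moment_coeff (1 / 2) (real DIM('k ^ 'n) / 2) i j"
  have "?m * ratio i * (\<integral>\<omega>. inner y (U \<omega>) ^ (2 * j) * norm (hinner u (U \<omega>)) ^ (2 * i) \<partial>M) =
      (\<integral>\<xi>. (\<integral>\<omega>. inner y (U \<omega>) ^ (2 * j) * inner (rscale u (V \<xi>)) (U \<omega>) ^ (2 * i) \<partial>M) \<partial>N)"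
    using assms abs_inner_U_le[of y]
    by (intro average_inner_rscale[symmetric, where B = 1]) (auto simp: power_abs intro!: power_le_one)
  also have "\<dots> = (\<integral>\<xi>. mass * (\<Sum>l\<le>min i j. ?c l * inner (V \<xi>) (hinner u y) ^ (2 * l)) \<partial>N)"
    using mixed_moment[OF moment_U assms(1), of "rscale u _" y] assms
    by (simp add: inner_rscale mult.commute)
  also have "\<dots> = mass * (\<Sum>l\<le>min i j. ?c l * (?m * ratio l * norm (hinner u y) ^ (2 * l)))"
  proof -
    have int: "integrable N (\<lambda>\<xi>. inner (V \<xi>) (hinner u y) ^ k)" for k
      using S.integrable_inner_U[of "hinner u y" k 0 0] by (simp add: inner_commute)
    have "(\<integral>\<xi>. (\<Sum>l\<le>min i j. ?c l * inner (V \<xi>) (hinner u y) ^ (2 * l)) \<partial>N) =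
        (\<Sum>l\<le>min i j. ?c l * (\<integral>\<xi>. inner (V \<xi>) (hinner u y) ^ (2 * l) \<partial>N))"
      by (subst Bochner_Integration.integral_sum) (auto intro!: integrable_mult_right int)
    also have "\<dots> = (\<Sum>l\<le>min i j. ?c l * (?m * ratio l * norm (hinner u y) ^ (2 * l)))"
      using assms by (intro sum.cong refl, subst integral_inner_V) auto
    finally show ?thesis by simp
  qed
  finally have "?m * ratio i * (\<integral>\<omega>. inner y (U \<omega>) ^ (2 * j) * norm (hinner u (U \<omega>)) ^ (2 * i) \<partial>M) =
    ?m * ratio i * (mass * (\<Sum>l\<le>min i j. ?c l * (ratio l / ratio i) * norm (hinner u y) ^ (2 * l)))"
    using ratio_pos[of i] by (simp add: sum_distrib_left mult_ac)
  then show ?thesis using ratio_pos[of i] S.mass_pos by simp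
qed

text \<open>The second averaging replaces \<open>v\<close> by \<open>rscale v c\<close> for a unit
  scalar c. This does not change \<open>norm (hinner u v)\<close>, so the only new factor is the
  divisor \<open>ratio j\<close>.\<close>

lemma mixed_moment_hermitian:
  assumes "i + j \<le> n" "norm u = 1" "norm v = 1"
  shows "(\<integral>\<omega>. norm (hinner u (U \<omega>)) ^ (2 * i) * norm (hinner v (U \<omega>)) ^ (2 * j) \<partial>M) =
    mass * (\<Sum>l\<le>min i j. moment_coeff (real DIM('k) / 2) (real DIM('k ^ 'n) / 2) i j l *
      norm (hinner u v) ^ (2 * l))"
proof -
  let ?m = "measure N (space N)" and ?c = "moment_coeff (1 / 2) (real DIM('k ^ 'n) / 2) i j"
  have "?m * ratio j * (\<integral>\<omega>. norm (hinner u (U \<omega>)) ^ (2 * i) * norm (hinner v (U \<omega>)) ^ (2 * j) \<partial>M) =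
      (\<integral>\<xi>. (\<integral>\<omega>. norm (hinner u (U \<omega>)) ^ (2 * i) * inner (rscale v (V \<xi>)) (U \<omega>) ^ (2 * j) \<partial>M) \<partial>N)"
    using assms norm_hinner_U_le[of u]
    by (intro average_inner_rscale[symmetric, where B = 1]) (auto intro!: power_le_one)
  also have "\<dots> = (\<integral>\<xi>. mass * (\<Sum>l\<le>min i j. ?c l * (ratio l / ratio i) *
      norm (hinner u v) ^ (2 * l)) \<partial>N)"
    using mixed_moment_real_hermitian[OF assms(1,2), of "rscale v _"] assms
    by (simp add: hinner_rscale norm_mult mult.commute)
  finally have "?m * ratio j * (\<integral>\<omega>. norm (hinner u (U \<omega>)) ^ (2 * i) * norm (hinner v (U \<omega>)) ^ (2 * j) \<partial>M) =
      ?m * ratio j * (mass * (\<Sum>l\<le>min i j. (\<lambda>l. ?c l * ratio l / (ratio i * ratio j)) l *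
        norm (hinner u v) ^ (2 * l)))"
    using ratio_pos[of j] by (simp add: sum_distrib_left mult_ac)
  also have "(\<lambda>l. ?c l * ratio l / (ratio i * ratio j)) =
      moment_coeff (real DIM('k) / 2) (real DIM('k ^ 'n) / 2) i j"
    unfolding ratio_def by (intro ext moment_coeff_ratio) simp
  finally show ?thesis using ratio_pos[of j] S.mass_pos by simp
qed

lemma zonal_polynomial_composition:
  assumes "2 * k \<le> n" "norm u = 1" "norm v = 1" "DIM('k ^ 'n) \<ge> 2"
  defines "p \<equiv> real DIM('k) / 2" and "L \<equiv> real DIM('k ^ 'n) / 2 - 1"
  defines "Z \<equiv> \<lambda>t. \<Sum>i\<le>k. zonal_coeff k L p i * t ^ (2 * i)"
  shows "(\<integral>\<omega>. Z (norm (hinner u (U \<omega>))) * Z (norm (hinner v (U \<omega>))) \<partial>M) =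
    mass * zonal_coeff k L p k * (fact k * pochhammer p k / pochhammer (L + 1) (2 * k)) *
      Z (norm (hinner u v))"
proof -
  let ?h = "zonal_coeff k L p"
  have "real DIM('k ^ 'n) \<ge> 2" using assms(4) by (metis of_nat_le_iff of_nat_numeral)
  then have L: "L \<ge> 0" by (simp add: L_def)
  have "(\<integral>\<omega>. Z (norm (hinner u (U \<omega>))) * Z (norm (hinner v (U \<omega>))) \<partial>M) =
      (\<integral>\<omega>. (\<Sum>i\<le>k. \<Sum>j\<le>k. ?h i * ?h j *
        (norm (hinner u (U \<omega>)) ^ (2 * i) * norm (hinner v (U \<omega>)) ^ (2 * j))) \<partial>M)"
    by (simp add: Z_def sum_product mult_ac)
  also have "\<dots> = (\<Sum>i\<le>k. \<Sum>j\<le>k. ?h i * ?h j *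
      (\<integral>\<omega>. norm (hinner u (U \<omega>)) ^ (2 * i) * norm (hinner v (U \<omega>)) ^ (2 * j) \<partial>M))"
    by (simp add: Bochner_Integration.integral_sum integrable_hinner_U)
  also have "\<dots> = (\<Sum>i\<le>k. \<Sum>j\<le>k. mass * (?h i * ?h j *
      (\<Sum>l\<le>min i j. moment_coeff p (L + 1) i j l * ((norm (hinner u v))\<^sup>2) ^ l)))"
    using assms by (intro sum.cong refl, subst mixed_moment_hermitian)
      (auto simp: p_def L_def power_mult)
  also have "\<dots> = mass * (\<Sum>i\<le>k. \<Sum>j\<le>k. ?h i * ?h j *
      (\<Sum>l\<le>min i j. moment_coeff p (L + 1) i j l * ((norm (hinner u v))\<^sup>2) ^ l))"
    by (simp only: sum_distrib_left)
  also have "\<dots> = mass * (zonal_coeff k L p k * (fact k * pochhammer p k / pochhammer (L + 1) (2 * k)) *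
      (\<Sum>l\<le>k. ?h l * ((norm (hinner u v))\<^sup>2) ^ l))"
    using L by (subst zonal_coeff_composition) (auto simp: p_def)
  finally show ?thesis by (simp add: Z_def power_mult mult.assoc)
qed

end

text \<open>This identity carries both the positive definiteness of zonal functions and their bound by
  \<open>1\<close>.\<close>

lemma zonal_convolution:
  assumes "CARD('n::finite) \<ge> 2"
  obtains M :: "('k::hermitian_scalar ^ 'n \<Rightarrow> real) measure"
    and U :: "('k ^ 'n \<Rightarrow> real) \<Rightarrow> 'k ^ 'n" and c
  where "random_unit_vector M U" "c > 0"
    "\<And>u v. norm u = 1 \<Longrightarrow> norm v = 1 \<Longrightarrow>
      (\<integral>\<omega>. zonal DIM('k) CARD('n) k (norm (hinner u (U \<omega>))) *
        zonal DIM('k) CARD('n) k (norm (hinner v (U \<omega>))) \<partial>M) =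
      c * zonal DIM('k) CARD('n) k (norm (hinner u v))"
proof -
  obtain N :: "('k \<Rightarrow> real) measure" and V :: "('k \<Rightarrow> real) \<Rightarrow> 'k" and C
    where N: "random_unit_vector N V" "random_unit_vector.even_moment N V (2 * k) C"
    by (rule ex_even_moment)
  obtain M :: "('k ^ 'n \<Rightarrow> real) measure" and U :: "('k ^ 'n \<Rightarrow> real) \<Rightarrow> 'k ^ 'n" and D
    where M: "random_unit_vector M U" "random_unit_vector.even_moment M U (2 * k) D"
    by (rule ex_even_moment)
  interpret random_unit_scalar_and_vector N V M U "2 * k" C D
    using N M by (simp add: random_unit_scalar_and_vector_def random_unit_scalar_and_vector_axioms_def)
  define p where "p = real DIM('k) / 2"
  define L where "L = real DIM('k ^ 'n) / 2 - 1"
  define \<alpha> where "\<alpha> = (real CARD('n) - 1) * p - 1"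
  define Z where "Z t = (\<Sum>i\<le>k. zonal_coeff k L p i * t ^ (2 * i))" for t
  define e where "e = (-1) ^ k * pochhammer p k / fact k / jacobi k \<alpha> (p - 1) 1"
  define c where "c = mass * zonal_coeff k L p k * (fact k * pochhammer p k / pochhammer (L + 1) (2 * k))"
  have "p > 0" by (simp add: p_def)
  have "CARD('n) * DIM('k) \<ge> 2 * 1" using assms by (intro mult_mono) auto
  then have DIM: "DIM('k ^ 'n) \<ge> 2" by simp
  then have "real DIM('k ^ 'n) \<ge> 2" by (metis of_nat_le_iff of_nat_numeral)
  then have "L \<ge> 0" by (simp add: L_def)
  have "\<alpha> > -1" using assms \<open>p > 0\<close> by (simp add: \<alpha>_def)
  have zonal: "zonal DIM('k) CARD('n) k t = e * Z t" for t
  proof -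
    have "\<alpha> + (p - 1) + 1 = L"
      by (simp add: \<alpha>_def L_def p_def field_simps)
    then have "jacobi k \<alpha> (p - 1) (2 * t\<^sup>2 - 1) = (-1) ^ k * pochhammer p k / fact k * Z t"
      using \<open>p > 0\<close> by (subst jacobi_hypergeometric) (simp_all add: Z_def power_mult)
    then show ?thesis by (simp add: zonal_def Let_def e_def \<alpha>_def p_def)
  qed
  \<comment> \<open>The normalisation \<open>e\<close> and the leading coefficient both carry the
    sign of (-1)^k, so their product is positive. As the zonal function is \<open>e * Z\<close> and
    convolution of \<open>Z\<close> with itself gives \<open>c * Z\<close>, the constant in question
    is \<open>e * c\<close>.\<close>
  have "e * zonal_coeff k L p k > 0"
  proof -
    have "(-1) ^ k * (-1) ^ k = (1 :: real)" by (simp flip: power_add)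
    then have "e * zonal_coeff k L p k =
        pochhammer (real k + L) k / (jacobi k \<alpha> (p - 1) 1 * fact k)"
      using pochhammer_pos[OF \<open>p > 0\<close>, of k]
      by (simp add: e_def zonal_coeff_def pochhammer_minus_nat)
    \<comment> \<open>In the real plane L is 0, so for k = 0 the base is not positive; the empty
      product is still 1.\<close>
    moreover have "pochhammer (real k + L) k > 0"
      using \<open>L \<ge> 0\<close> by (cases "k = 0") (auto intro!: pochhammer_pos)
    ultimately show ?thesis using jacobi_at_1_pos[OF \<open>\<alpha> > -1\<close>] by simp
  qed
  moreover have "mass * (fact k * pochhammer p k / pochhammer (L + 1) (2 * k)) > 0"
    using mass_pos \<open>p > 0\<close> \<open>L \<ge> 0\<close> by (intro mult_pos_pos divide_pos_pos pochhammer_pos) auto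
  moreover have "e * c = (e * zonal_coeff k L p k) *
      (mass * (fact k * pochhammer p k / pochhammer (L + 1) (2 * k)))"
    by (simp add: c_def)
  ultimately have "e * c > 0" by (metis mult_pos_pos)
  moreover have "(\<integral>\<omega>. zonal DIM('k) CARD('n) k (norm (hinner u (U \<omega>))) *
        zonal DIM('k) CARD('n) k (norm (hinner v (U \<omega>))) \<partial>M) =
      e * c * zonal DIM('k) CARD('n) k (norm (hinner u v))"
    if "norm u = 1" "norm v = 1" for u v
  proof -
    have "(\<integral>\<omega>. zonal DIM('k) CARD('n) k (norm (hinner u (U \<omega>))) *
        zonal DIM('k) CARD('n) k (norm (hinner v (U \<omega>))) \<partial>M) =
      (\<integral>\<omega>. e * e * (Z (norm (hinner u (U \<omega>))) * Z (norm (hinner v (U \<omega>)))) \<partial>M)"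
      by (simp only: zonal mult_ac)
    also have "\<dots> = e * e * (\<integral>\<omega>. Z (norm (hinner u (U \<omega>))) * Z (norm (hinner v (U \<omega>))) \<partial>M)"
      by simp
    also have "(\<integral>\<omega>. Z (norm (hinner u (U \<omega>))) * Z (norm (hinner v (U \<omega>))) \<partial>M) =
      c * Z (norm (hinner u v))"
      unfolding Z_def c_def p_def L_def
      by (rule zonal_polynomial_composition[OF _ that DIM]) simp
    finally show ?thesis by (simp add: zonal mult_ac)
  qed
  ultimately show thesis using that[OF M(1)] by blast
qed

section \<open>Continuity and boundedness of zonal functions\<close>

lemma continuous_on_zonal [continuous_intros]:
  "continuous_on S f \<Longrightarrow> continuous_on S (\<lambda>x. zonal m d k (f x))"
  unfolding zonal_def jacobi_def Let_def divide_inverse by (intro continuous_intros)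

lemma borel_measurable_zonal [measurable]:
  "f \<in> borel_measurable M \<Longrightarrow> (\<lambda>x. zonal m d k (f x)) \<in> borel_measurable M"
  using borel_measurable_continuous_on[OF continuous_on_zonal[OF continuous_on_id]] .

lemma zonal_at_1: "d \<ge> 2 \<Longrightarrow> m > 0 \<Longrightarrow> zonal m d k 1 = 1"
  using jacobi_at_1_pos[of "(real d - 1) * (real m / 2) - 1" k "real m / 2 - 1"]
  by (simp add: zonal_def Let_def)

lemma bounded_zonal: "\<exists>B. \<forall>t\<in>{0..1}. \<bar>zonal m d k t\<bar> \<le> B"
proof -
  have "compact (zonal m d k ` {0..1})"
    by (intro compact_continuous_image continuous_on_zonal continuous_on_id) simp
  from compact_imp_bounded[OF this] show ?thesis
    by (auto simp: bounded_iff)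
qed

text \<open>Cauchy--Schwarz for a reproducing kernel: \<open>c * ?z u v\<close> is the inner product
  of the functions \<open>?z u _\<close> and \<open>?z v _\<close>, each of which has square norm
  \<open>c\<close> because \<open>?z u u = 1\<close>. With equal norms the inequality between
  arithmetic and geometric means suffices.\<close>

lemma abs_zonal_le_1:
  fixes u v :: "'k::hermitian_scalar ^ 'n"
  assumes "CARD('n) \<ge> 2" and uv: "norm u = 1" "norm v = 1"
  shows "\<bar>zonal DIM('k) CARD('n) k (norm (hinner u v))\<bar> \<le> 1"
proof -
  let ?z = "\<lambda>x y :: 'k ^ 'n. zonal DIM('k) CARD('n) k (norm (hinner x y))"
  obtain M :: "('k ^ 'n \<Rightarrow> real) measure" and U c where M: "random_unit_vector M U" and c: "c > 0"
    and conv: "\<And>u v. norm u = 1 \<Longrightarrow> norm v = 1 \<Longrightarrow> (\<integral>\<omega>. ?z u (U \<omega>) * ?z v (U \<omega>) \<partial>M) = c * ?z u v"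
    by (rule zonal_convolution[OF assms(1), where 'k = 'k]) blast
  interpret random_unit_vector M U by (fact M)
  obtain B where B: "\<And>t. 0 \<le> t \<Longrightarrow> t \<le> 1 \<Longrightarrow> \<bar>zonal DIM('k) CARD('n) k t\<bar> \<le> B"
    using bounded_zonal[of "DIM('k)" "CARD('n)" k] by (metis atLeastAtMost_iff)
  have z_le: "\<bar>?z x (U \<omega>)\<bar> \<le> B" if "norm x = 1" for x \<omega>
    using norm_hinner_le[of x "U \<omega>"] that by (intro B) auto
  have int: "integrable M (\<lambda>\<omega>. ?z x (U \<omega>) * ?z y (U \<omega>))" if "norm x = 1" "norm y = 1" for x y
  proof (rule integrable_const_bound[where B = "B * B"])
    have "0 \<le> B" using B[of 0] by simp
    then show "AE \<omega> in M. norm (?z x (U \<omega>) * ?z y (U \<omega>)) \<le> B * B"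
      using that by (auto simp: abs_mult intro!: AE_I2 mult_mono z_le)
  qed simp
  have z1: "?z x x = 1" if "norm x = 1" for x
    using that assms(1) by (simp add: hinner_self zonal_at_1)
  have "(\<integral>\<omega>. \<bar>?z u (U \<omega>) * ?z v (U \<omega>)\<bar> \<partial>M) \<le>
      (\<integral>\<omega>. (?z u (U \<omega>) * ?z u (U \<omega>) + ?z v (U \<omega>) * ?z v (U \<omega>)) / 2 \<partial>M)"
  proof (rule integral_mono)
    fix \<omega>
    have "0 \<le> (\<bar>?z u (U \<omega>)\<bar> - \<bar>?z v (U \<omega>)\<bar>)\<^sup>2" by simp
    then show "\<bar>?z u (U \<omega>) * ?z v (U \<omega>)\<bar> \<le> (?z u (U \<omega>) * ?z u (U \<omega>) + ?z v (U \<omega>) * ?z v (U \<omega>)) / 2"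
      by (simp add: power2_eq_square abs_mult algebra_simps)
  qed (use int uv in auto)
  also have "\<dots> = c" using int uv by (simp add: conv z1)
  finally have "\<bar>c * ?z u v\<bar> \<le> c"
    using integral_abs_bound[of M "\<lambda>\<omega>. ?z u (U \<omega>) * ?z v (U \<omega>)"] conv[OF uv] by simp
  then show ?thesis using c by (simp add: abs_mult)
qed

section \<open>Moments of isotropic measures\<close>

lemma (in pair_sigma_finite)
  fixes f :: "'a \<Rightarrow> real" and g :: "'b \<Rightarrow> real"
  assumes f: "integrable M1 f" and g: "integrable M2 g"
  shows integrable_mult_pair: "integrable (M1 \<Otimes>\<^sub>M M2) (\<lambda>(x, y). f x * g y)"
    and integral_mult_pair: "(\<integral>(x, y). f x * g y \<partial>(M1 \<Otimes>\<^sub>M M2)) = (\<integral>x. f x \<partial>M1) * (\<integral>y. g y \<partial>M2)"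
proof -
  have [measurable]: "f \<in> borel_measurable M1" "g \<in> borel_measurable M2" using f g by auto
  show *: "integrable (M1 \<Otimes>\<^sub>M M2) (\<lambda>(x, y). f x * g y)"
    using f g by (intro Fubini_integrable) (simp_all add: abs_mult)
  show "(\<integral>(x, y). f x * g y \<partial>(M1 \<Otimes>\<^sub>M M2)) = (\<integral>x. f x \<partial>M1) * (\<integral>y. g y \<partial>M2)"
    using integral_fst[OF *] by simp
qed

text \<open>The convolution identity factorises the kernel over a random unit vector, and Fubini
  then turns the double integral into the integral of a square. Unit length of \<open>s x\<close> is
  asked only where \<open>w x \<noteq> 0\<close>, since in the application \<open>s\<close> is
  \<open>sgn\<close>, which is 0 at the origin.\<close>

lemma zonal_positive_definite:
  fixes s :: "'x \<Rightarrow> 'k::hermitian_scalar ^ 'n" and w :: "'x \<Rightarrow> real"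
  assumes "CARD('n) \<ge> 2" "sigma_finite_measure \<mu>" and w: "integrable \<mu> w"
    and [measurable]: "s \<in> borel_measurable \<mu>" and s: "\<And>x. w x \<noteq> 0 \<Longrightarrow> norm (s x) = 1"
  shows "0 \<le> (\<integral>(x, y). w x * w y * zonal DIM('k) CARD('n) k (norm (hinner (s x) (s y))) \<partial>(\<mu> \<Otimes>\<^sub>M \<mu>))"
proof -
  let ?z = "\<lambda>x y :: 'k ^ 'n. zonal DIM('k) CARD('n) k (norm (hinner x y))"
  obtain M :: "('k ^ 'n \<Rightarrow> real) measure" and U c where M: "random_unit_vector M U" and c: "c > 0"
    and conv: "\<And>u v. norm u = 1 \<Longrightarrow> norm v = 1 \<Longrightarrow> (\<integral>\<omega>. ?z u (U \<omega>) * ?z v (U \<omega>) \<partial>M) = c * ?z u v"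
    by (rule zonal_convolution[OF assms(1), where 'k = 'k]) blast
  interpret random_unit_vector M U by (fact M)
  interpret \<mu>: sigma_finite_measure \<mu> by fact
  interpret P: pair_sigma_finite \<mu> \<mu> ..
  interpret sigma_finite_measure "\<mu> \<Otimes>\<^sub>M \<mu>" by (rule P.sigma_finite_measure_axioms)
  interpret Q: pair_sigma_finite "\<mu> \<Otimes>\<^sub>M \<mu>" M ..
  have [measurable]: "w \<in> borel_measurable \<mu>" using w by auto
  obtain B where B: "\<And>t. 0 \<le> t \<Longrightarrow> t \<le> 1 \<Longrightarrow> \<bar>zonal DIM('k) CARD('n) k t\<bar> \<le> B"
    using bounded_zonal[of "DIM('k)" "CARD('n)" k] by (metis atLeastAtMost_iff)
  define h where "h x \<omega> = w x * ?z (s x) (U \<omega>)" for x \<omega>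
  have [measurable]: "case_prod h \<in> borel_measurable (\<mu> \<Otimes>\<^sub>M M)" unfolding h_def by measurable
  have h_le: "\<bar>h x \<omega>\<bar> \<le> B * \<bar>w x\<bar>" for x \<omega>
  proof (cases "w x = 0")
    case False
    then have "norm (hinner (s x) (U \<omega>)) \<le> 1" using norm_hinner_le[of "s x" "U \<omega>"] s by simp
    then show ?thesis
      using mult_right_mono[OF B, of "norm (hinner (s x) (U \<omega>))" "\<bar>w x\<bar>"]
      by (simp add: h_def abs_mult mult.commute)
  qed (simp add: h_def)
  have int_h: "integrable \<mu> (\<lambda>x. h x \<omega>)" for \<omega>
  proof (rule Bochner_Integration.integrable_bound)
    show "integrable \<mu> (\<lambda>x. B * \<bar>w x\<bar>)" using w by simp
    show "AE x in \<mu>. norm (h x \<omega>) \<le> norm (B * \<bar>w x\<bar>)"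
      unfolding real_norm_def by (intro AE_I2 order_trans[OF h_le abs_ge_self])
  qed (simp add: h_def)
  have int: "integrable ((\<mu> \<Otimes>\<^sub>M \<mu>) \<Otimes>\<^sub>M M) (case_prod (\<lambda>p \<omega>. h (fst p) \<omega> * h (snd p) \<omega>))"
  proof (rule Bochner_Integration.integrable_bound)
    have "integrable (\<mu> \<Otimes>\<^sub>M \<mu>) (\<lambda>(x, y). (B * \<bar>w x\<bar>) * (B * \<bar>w y\<bar>))"
      using w by (intro P.integrable_mult_pair) auto
    from Q.integrable_mult_pair[OF this, of "\<lambda>_. 1"]
    show "integrable ((\<mu> \<Otimes>\<^sub>M \<mu>) \<Otimes>\<^sub>M M) (\<lambda>(p, \<omega>). (B * \<bar>w (fst p)\<bar>) * (B * \<bar>w (snd p)\<bar>))"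
      by (simp add: case_prod_beta')
    have "\<bar>h x \<omega> * h y \<omega>\<bar> \<le> \<bar>(B * \<bar>w x\<bar>) * (B * \<bar>w y\<bar>)\<bar>" for x y \<omega>
      unfolding abs_mult[of "h x \<omega>"] abs_mult[of "B * \<bar>w x\<bar>"]
      by (intro mult_mono order_trans[OF h_le abs_ge_self]) auto
    then show "AE z in (\<mu> \<Otimes>\<^sub>M \<mu>) \<Otimes>\<^sub>M M. norm (case z of (p, \<omega>) \<Rightarrow> h (fst p) \<omega> * h (snd p) \<omega>) \<le>
        norm (case z of (p, \<omega>) \<Rightarrow> (B * \<bar>w (fst p)\<bar>) * (B * \<bar>w (snd p)\<bar>))"
      by (auto simp: case_prod_beta')
  qed (unfold h_def, measurable)
  have "c * (w x * w y * ?z (s x) (s y)) = (\<integral>\<omega>. h x \<omega> * h y \<omega> \<partial>M)" for x y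
  proof (cases "w x = 0 \<or> w y = 0")
    case False
    have "(\<integral>\<omega>. h x \<omega> * h y \<omega> \<partial>M) = (\<integral>\<omega>. w x * w y * (?z (s x) (U \<omega>) * ?z (s y) (U \<omega>)) \<partial>M)"
      by (simp add: h_def mult_ac)
    also have "\<dots> = w x * w y * (c * ?z (s x) (s y))"
      using False s by (simp add: conv)
    finally show ?thesis by simp
  qed (auto simp: h_def)
  then have "c * (\<integral>(x, y). w x * w y * ?z (s x) (s y) \<partial>(\<mu> \<Otimes>\<^sub>M \<mu>)) =
      (\<integral>p. (\<integral>\<omega>. h (fst p) \<omega> * h (snd p) \<omega> \<partial>M) \<partial>(\<mu> \<Otimes>\<^sub>M \<mu>))"
    by (simp add: case_prod_beta' flip: integral_mult_right_zero)
  also have "\<dots> = (\<integral>\<omega>. (\<integral>p. h (fst p) \<omega> * h (snd p) \<omega> \<partial>(\<mu> \<Otimes>\<^sub>M \<mu>)) \<partial>M)"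
    by (rule Q.Fubini_integral[OF int, symmetric])
  also have "\<dots> = (\<integral>\<omega>. (\<integral>x. h x \<omega> \<partial>\<mu>) * (\<integral>x. h x \<omega> \<partial>\<mu>) \<partial>M)"
  proof -
    have "(\<integral>p. h (fst p) \<omega> * h (snd p) \<omega> \<partial>(\<mu> \<Otimes>\<^sub>M \<mu>)) = (\<integral>x. h x \<omega> \<partial>\<mu>) * (\<integral>x. h x \<omega> \<partial>\<mu>)" for \<omega>
      using P.integral_mult_pair[OF int_h[of \<omega>] int_h[of \<omega>]] by (simp add: case_prod_beta')
    then show ?thesis by simp
  qed
  also have "\<dots> \<ge> 0" by simp
  finally show ?thesis using c by (simp add: zero_le_mult_iff)
qed

text \<open>Weighted arithmetic-geometric mean inequality, as \<open>q\<close> is the convex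
  combination (2 - q) * 1 + (q - 1) * 2 of the exponents 1 and 2.\<close>

lemma powr_le_interpolation:
  fixes q z :: real
  assumes "1 \<le> q" "q \<le> 2" "0 \<le> z"
  shows "z powr q \<le> (2 - q) * z + (q - 1) * z\<^sup>2"
proof (cases "z = 0")
  case False
  then have "z powr (2 - q) * z\<^sup>2 powr (q - 1) \<le> (2 - q) * z + (q - 1) * z\<^sup>2"
    using assms by (intro Youngs_inequality_0) auto
  moreover have "z powr (2 - q) * z\<^sup>2 powr (q - 1) = z powr q"
    using False assms by (simp add: powr_powr flip: powr_add powr_numeral)
  ultimately show ?thesis by simp
qed simp

text \<open>A bound of \<open>(r * s) powr q\<close> by a polynomial whose integrals are determined by isotropy.\<close>

lemma powr_mult_le_interpolation:
  fixes q r s :: real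
  assumes "1 \<le> q" "q \<le> 2" "0 \<le> r" "0 \<le> s"
  shows "r powr q * s powr q \<le> (2 - q) / 2 * (r\<^sup>2 + s\<^sup>2) + (q - 1) * (r\<^sup>2 * s\<^sup>2)"
proof -
  have "r powr q * s powr q = (r * s) powr q"
    using assms by (simp add: powr_mult)
  also have "\<dots> \<le> (2 - q) * (r * s) + (q - 1) * (r * s)\<^sup>2"
    using assms by (intro powr_le_interpolation) auto
  also have "(2 - q) * (r * s) \<le> (2 - q) * ((r\<^sup>2 + s\<^sup>2) / 2)"
    using assms sum_squares_bound[of r s] by (intro mult_left_mono) auto
  finally show ?thesis by (simp add: power_mult_distrib)
qed

section \<open>Second moments of an isotropic measure\<close>

locale isotropic_measure =
  fixes \<mu> :: "('k::hermitian_scalar ^ 'n) measure"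
  assumes isotropic: "isotropic \<mu>"
begin

sublocale prob_space \<mu> using isotropic by (simp add: isotropic_def)

sublocale P: pair_sigma_finite \<mu> \<mu> ..

lemma sets_eq [measurable_cong]: "sets \<mu> = sets borel"
  using isotropic by (simp add: isotropic_def)

text \<open>Isotropy is used through real linear functionals of the rank-one matrix: the squared
  norm is a trace, and the squared product with a fixed vector is a quadratic form in that vector,
  linear in the matrix.\<close>

lemma linear_outer_square:
  fixes T :: "'k ^ 'n ^ 'n \<Rightarrow> real"
  assumes "linear T"
  shows "integrable \<mu> (\<lambda>x. T (outer_square x))"
    and "(\<integral>x. T (outer_square x) \<partial>\<mu>) = T (mat 1) / real CARD('n)"
proof -
  have T: "bounded_linear T" using assms by (simp add: linear_conv_bounded_linear)
  have int: "integrable \<mu> outer_square" using isotropic by (simp add: isotropic_def)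
  show "integrable \<mu> (\<lambda>x. T (outer_square x))"
    by (rule integrable_bounded_linear[OF T int])
  show "(\<integral>x. T (outer_square x) \<partial>\<mu>) = T (mat 1) / real CARD('n)"
    using integral_bounded_linear[OF T int] isotropic linear_scale[OF assms]
    by (simp add: isotropic_def)
qed

lemma
  shows integrable_norm_square: "integrable \<mu> (\<lambda>x. (norm x)\<^sup>2)"
    and integral_norm_square: "(\<integral>x. (norm x)\<^sup>2 \<partial>\<mu>) = 1"
proof -
  let ?T = "\<lambda>A :: 'k ^ 'n ^ 'n. \<Sum>i\<in>UNIV. inner (A $ i $ i) 1"
  have T: "linear ?T"
    by (rule linearI) (simp_all add: inner_add_left sum.distrib sum_distrib_left)
  have "?T (outer_square x) = (norm x)\<^sup>2" for x
    by (simp add: outer_square_def mult_hconj_self norm_vec_def L2_set_def sum_nonneg)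
  then show "integrable \<mu> (\<lambda>x. (norm x)\<^sup>2)" "(\<integral>x. (norm x)\<^sup>2 \<partial>\<mu>) = 1"
    using linear_outer_square[OF T] by (simp_all add: mat_def)
qed

lemma
  shows integrable_hinner_square: "integrable \<mu> (\<lambda>x. (norm (hinner x y))\<^sup>2)"
    and integral_hinner_square: "(\<integral>x. (norm (hinner x y))\<^sup>2 \<partial>\<mu>) = (norm y)\<^sup>2 / real CARD('n)"
proof -
  \<comment> \<open>The real part of the quadratic form \<open>y\<close>* A \<open>y\<close>. The
    order of the factors matters for quaternions; it makes the form at \<open>outer_square x\<close>
    equal to \<open>hinner y x * hinner x y\<close>.\<close>
  let ?T = "\<lambda>A :: 'k ^ 'n ^ 'n. inner (\<Sum>i\<in>UNIV. \<Sum>j\<in>UNIV. hconj (y $ i) * A $ i $ j * y $ j) 1"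
  have T: "linear ?T"
    by (rule linearI) (simp_all add: distrib_left distrib_right sum.distrib inner_add_left
        flip: scaleR_right.sum)
  have "?T (outer_square x) = (norm (hinner x y))\<^sup>2" for x
  proof -
    have "(\<Sum>i\<in>UNIV. \<Sum>j\<in>UNIV. hconj (y $ i) * outer_square x $ i $ j * y $ j) =
        hinner y x * hinner x y"
      by (simp add: outer_square_def hinner_def sum_product mult.assoc)
    also have "\<dots> = (norm (hinner x y))\<^sup>2 *\<^sub>R 1"
      by (metis hconj_hinner hconj_mult_self)
    finally show ?thesis by simp
  qed
  moreover have "?T (mat 1) = (norm y)\<^sup>2"
  proof -
    have "(\<Sum>j\<in>UNIV. hconj (y $ i) * mat 1 $ i $ j * y $ j) = hconj (y $ i) * y $ i" for i
      by (simp add: mat_def if_distrib if_distribR cong: if_cong)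
    then have "?T (mat 1) = inner (hinner y y) 1" by (simp add: hinner_def)
    then show ?thesis by (simp add: hinner_self)
  qed
  ultimately show "integrable \<mu> (\<lambda>x. (norm (hinner x y))\<^sup>2)"
    "(\<integral>x. (norm (hinner x y))\<^sup>2 \<partial>\<mu>) = (norm y)\<^sup>2 / real CARD('n)"
    using linear_outer_square[OF T] by simp_all
qed

text \<open>Applied below with \<open>f = sgn\<close>, which leaves one radial factor beside the
  squared cosine, and with the identity, which leaves both.\<close>

lemma
  assumes [measurable]: "f \<in> borel_measurable \<mu>" and f: "integrable \<mu> (\<lambda>y. (norm (f y))\<^sup>2)"
  shows integrable_hinner_square_pair:
      "integrable (\<mu> \<Otimes>\<^sub>M \<mu>) (\<lambda>(y, x). (norm (hinner x (f y)))\<^sup>2)"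
    and integral_hinner_square_pair: "(\<integral>(y, x). (norm (hinner x (f y)))\<^sup>2 \<partial>(\<mu> \<Otimes>\<^sub>M \<mu>)) =
      (\<integral>y. (norm (f y))\<^sup>2 \<partial>\<mu>) / real CARD('n)"
proof -
  show *: "integrable (\<mu> \<Otimes>\<^sub>M \<mu>) (\<lambda>(y, x). (norm (hinner x (f y)))\<^sup>2)"
    using f by (intro P.Fubini_integrable)
      (simp_all add: integral_hinner_square integrable_hinner_square)
  show "(\<integral>(y, x). (norm (hinner x (f y)))\<^sup>2 \<partial>(\<mu> \<Otimes>\<^sub>M \<mu>)) =
      (\<integral>y. (norm (f y))\<^sup>2 \<partial>\<mu>) / real CARD('n)"
    using P.integral_fst[OF *] by (simp add: integral_hinner_square)
qed

end

section \<open>The moment bound in polar coordinates\<close>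

lemma hinner_0 [simp]: "hinner 0 x = 0" "hinner x 0 = (0 :: 'k::hermitian_scalar)"
  by (simp_all add: hinner_def)

lemma norm_hinner_polar:
  "norm (hinner x y) = norm x * norm y * norm (hinner (sgn x) (sgn (y :: 'k::hermitian_scalar ^ 'n)))"
  by (cases "x = 0"; cases "y = 0") (simp_all add: sgn_div_norm hinner_scaleR field_simps)

lemma (in isotropic_measure) moment_le:
  assumes d: "CARD('n) \<ge> 2" and q: "1 \<le> q" "q \<le> 2"
    and a: "a 0 \<ge> 0" "a 1 \<ge> 0" "\<And>k. k \<ge> 2 \<Longrightarrow> a k \<le> 0"
    and summable: "\<And>t. 0 \<le> t \<Longrightarrow> t \<le> 1 \<Longrightarrow> summable (\<lambda>k. a (k + 2) * zonal DIM('k) CARD('n) (k + 2) t)"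
    and le: "\<And>t. 0 \<le> t \<Longrightarrow> t \<le> 1 \<Longrightarrow>
      t powr q \<le> a 0 + a 1 * t\<^sup>2 + (\<Sum>k. a (k + 2) * zonal DIM('k) CARD('n) (k + 2) t)"
  shows "moment q \<mu> \<le> ennreal (a 1 / real CARD('n) + a 0)"
proof -
  let ?P = "\<mu> \<Otimes>\<^sub>M \<mu>" and ?d = "real CARD('n)"
  define w :: "'k ^ 'n \<Rightarrow> real" where "w x = norm x powr q" for x
  define t :: "'k ^ 'n \<Rightarrow> 'k ^ 'n \<Rightarrow> real" where "t y x = norm (hinner (sgn y) (sgn x))" for x y
  define z where "z k y x = zonal DIM('k) CARD('n) (k + 2) (t y x)" for k y x
  define S where "S y x = (\<Sum>k. a (k + 2) * z k y x)" for y x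
  have sgn [measurable]: "(sgn :: 'k ^ 'n \<Rightarrow> 'k ^ 'n) \<in> borel_measurable borel"
    unfolding sgn_div_norm by measurable
  have [measurable]: "w \<in> borel_measurable borel" unfolding w_def by measurable
  have t_meas [measurable]: "(\<lambda>(y, x). t y x) \<in> borel_measurable ?P"
    unfolding t_def by measurable
  have z_meas [measurable]: "(\<lambda>(y, x). z k y x) \<in> borel_measurable ?P" for k
    unfolding z_def by measurable
  have t_01: "0 \<le> t y x" "t y x \<le> 1" for y x
  proof -
    have "norm (sgn y) * norm (sgn x) \<le> 1" by (simp add: norm_sgn)
    then show "t y x \<le> 1" unfolding t_def using norm_hinner_le order_trans by blast
  qed (simp add: t_def)
  have t_commute: "t y x = t x y" for y x by (simp add: t_def norm_hinner_commute)
  have w_nonneg: "w x \<ge> 0" for x by (simp add: w_def)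
  have w_sgn: "norm (sgn x) = 1" if "w x \<noteq> 0" for x using that by (auto simp: w_def norm_sgn)
  have w_mult_le: "w y * w x \<le> (2 - q) / 2 * ((norm y)\<^sup>2 + (norm x)\<^sup>2) +
      (q - 1) * ((norm y)\<^sup>2 * (norm x)\<^sup>2)" for x y
    unfolding w_def using q by (intro powr_mult_le_interpolation) auto
  have int_w: "integrable \<mu> w"
  proof (rule Bochner_Integration.integrable_bound)
    \<comment> \<open>The interpolation bound at s = 1.\<close>
    show "integrable \<mu> (\<lambda>x. (2 - q) / 2 * ((norm x)\<^sup>2 + 1) + (q - 1) * (norm x)\<^sup>2)"
      by (intro Bochner_Integration.integrable_add integrable_mult_right integrable_norm_square) simp
    have "norm (w x) \<le> norm ((2 - q) / 2 * ((norm x)\<^sup>2 + 1) + (q - 1) * (norm x)\<^sup>2)" for x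
      using powr_mult_le_interpolation[of q "norm x" 1] q w_nonneg[of x] by (simp add: w_def)
    then show "AE x in \<mu>. norm (w x) \<le> norm ((2 - q) / 2 * ((norm x)\<^sup>2 + 1) + (q - 1) * (norm x)\<^sup>2)"
      by simp
  qed simp
  have int_ww: "integrable ?P (\<lambda>(y, x). w y * w x)"
    by (rule P.integrable_mult_pair[OF int_w int_w])

  have ww: "(\<integral>(y, x). w y * w x \<partial>?P) \<le> 1"
  proof -
    have ints: "integrable ?P (\<lambda>(y, x). (norm y)\<^sup>2)" "integrable ?P (\<lambda>(y, x). (norm x)\<^sup>2)"
      "integrable ?P (\<lambda>(y, x). (norm y)\<^sup>2 * (norm x)\<^sup>2)"
      and eqs: "(\<integral>(y, x). (norm y)\<^sup>2 \<partial>?P) = 1" "(\<integral>(y, x). (norm x)\<^sup>2 \<partial>?P) = 1"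
      "(\<integral>(y, x). (norm y)\<^sup>2 * (norm x)\<^sup>2 \<partial>?P) = 1"
      using P.integrable_mult_pair[OF integrable_norm_square, of "\<lambda>_. 1"]
        P.integral_mult_pair[OF integrable_norm_square, of "\<lambda>_. 1"]
        P.integrable_mult_pair[OF _ integrable_norm_square, of "\<lambda>_. 1"]
        P.integral_mult_pair[OF _ integrable_norm_square, of "\<lambda>_. 1"]
        P.integrable_mult_pair[OF integrable_norm_square integrable_norm_square]
        P.integral_mult_pair[OF integrable_norm_square integrable_norm_square]
      by (simp_all add: integral_norm_square prob_space)
    have "(\<integral>p. w (fst p) * w (snd p) \<partial>?P) \<le> (\<integral>p. (2 - q) / 2 * ((norm (fst p))\<^sup>2 + (norm (snd p))\<^sup>2) +
        (q - 1) * ((norm (fst p))\<^sup>2 * (norm (snd p))\<^sup>2) \<partial>?P)"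
    proof (rule integral_mono)
      show "integrable ?P (\<lambda>p. w (fst p) * w (snd p))"
        using int_ww by (simp add: case_prod_beta')
      show "integrable ?P (\<lambda>p. (2 - q) / 2 * ((norm (fst p))\<^sup>2 + (norm (snd p))\<^sup>2) +
          (q - 1) * ((norm (fst p))\<^sup>2 * (norm (snd p))\<^sup>2))"
        using ints by (simp add: case_prod_beta')
    qed (rule w_mult_le)
    also have "\<dots> = (2 - q) / 2 * (1 + 1) + (q - 1) * 1"
      using ints eqs by (simp add: case_prod_beta')
    also have "\<dots> = 1" by (simp add: field_simps)
    finally show ?thesis by (simp add: case_prod_beta')
  qed

  have int_wwt: "integrable ?P (\<lambda>(y, x). w y * w x * (t y x)\<^sup>2)"
    and wwt: "(\<integral>(y, x). w y * w x * (t y x)\<^sup>2 \<partial>?P) \<le> 1 / ?d"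
  proof -
    \<comment> \<open>In polar form \<open>?f (y, x)\<close>, \<open>?f (x, y)\<close> and
      \<open>?g (y, x)\<close> are the squared cosine times the squared norm of \<open>x\<close>, of
      \<open>y\<close>, and of both: the three terms of the interpolation bound.\<close>
    let ?f = "\<lambda>(y, x). (norm (hinner x (sgn y)))\<^sup>2" and ?g = "\<lambda>(y, x). (norm (hinner x y))\<^sup>2"
    have f_eq: "?f (y, x) = (norm x)\<^sup>2 * (t y x)\<^sup>2" and g_eq: "?g (y, x) = (norm y)\<^sup>2 * (norm x)\<^sup>2 * (t y x)\<^sup>2" for x y
    proof -
      have "sgn (sgn y) = sgn y"
        by (cases "y = 0") (simp_all add: sgn_div_norm[of "sgn y"] norm_sgn)
      then show "?f (y, x) = (norm x)\<^sup>2 * (t y x)\<^sup>2"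
        using norm_hinner_polar[of x "sgn y"] by (cases "y = 0")
          (simp_all add: t_def norm_sgn power_mult_distrib norm_hinner_commute[of "sgn y"])
      show "?g (y, x) = (norm y)\<^sup>2 * (norm x)\<^sup>2 * (t y x)\<^sup>2"
        using norm_hinner_polar[of x y] by (simp add: t_def power_mult_distrib norm_hinner_commute[of "sgn y"])
    qed
    have int_sgn: "integrable \<mu> (\<lambda>x. (norm (sgn x))\<^sup>2)"
      by (rule integrable_const_bound[where B = 1]) (auto simp: norm_sgn)
    \<comment> \<open>An inequality only, since \<open>\<mu>\<close> may charge the origin, where
      \<open>sgn\<close> is 0.\<close>
    have "(\<integral>x. (norm (sgn x))\<^sup>2 \<partial>\<mu>) \<le> (\<integral>x. 1 \<partial>\<mu>)"
      by (intro integral_mono int_sgn) (auto simp: norm_sgn)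
    then have sgn_le: "(\<integral>x. (norm (sgn x))\<^sup>2 \<partial>\<mu>) \<le> 1" by (simp add: prob_space)
    have f: "integrable ?P ?f" "integral\<^sup>L ?P ?f \<le> 1 / ?d"
      using integrable_hinner_square_pair[of sgn] integral_hinner_square_pair[of sgn] int_sgn sgn_le
      by (simp_all add: divide_right_mono)
    have f': "integrable ?P (\<lambda>(y, x). ?f (x, y))" "(\<integral>(y, x). ?f (x, y) \<partial>?P) \<le> 1 / ?d"
      using f P.integrable_product_swap[of ?f] P.integral_product_swap[of ?f] by auto
    have g: "integrable ?P ?g" "integral\<^sup>L ?P ?g = 1 / ?d"
      using integrable_hinner_square_pair[of "\<lambda>y. y"] integral_hinner_square_pair[of "\<lambda>y. y"]
        integrable_norm_square integral_norm_square by simp_all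
    have bound: "w y * w x * (t y x)\<^sup>2 \<le> (2 - q) / 2 * (?f (x, y) + ?f (y, x)) + (q - 1) * ?g (y, x)" for x y
      using mult_right_mono[OF w_mult_le[of y x], of "(t y x)\<^sup>2"]
      unfolding f_eq g_eq t_commute[of x y] by (simp add: algebra_simps)
    let ?b = "\<lambda>p. (2 - q) / 2 * (?f (snd p, fst p) + ?f p) + (q - 1) * ?g p"
    have int_b: "integrable ?P ?b"
      using f f' g by (simp add: case_prod_beta')
    show int: "integrable ?P (\<lambda>(y, x). w y * w x * (t y x)\<^sup>2)"
    proof (rule Bochner_Integration.integrable_bound[OF int_b])
      have "norm (case p of (y, x) \<Rightarrow> w y * w x * (t y x)\<^sup>2) \<le> norm (?b p)" for p
      proof (cases p)
        case (Pair y x)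
        have "0 \<le> w y * w x * (t y x)\<^sup>2" by (simp add: w_nonneg)
        with bound[of y x] show ?thesis
          unfolding Pair prod.case fst_conv snd_conv real_norm_def by linarith
      qed
      then show "AE p in ?P. norm (case p of (y, x) \<Rightarrow> w y * w x * (t y x)\<^sup>2) \<le> norm (?b p)"
        by blast
    qed measurable
    have "(\<integral>(y, x). w y * w x * (t y x)\<^sup>2 \<partial>?P) \<le> integral\<^sup>L ?P ?b"
      using bound by (intro integral_mono int int_b) (auto simp: case_prod_beta')
    also have "integral\<^sup>L ?P ?b = (2 - q) / 2 * ((\<integral>(y, x). ?f (x, y) \<partial>?P) + integral\<^sup>L ?P ?f) +
        (q - 1) * integral\<^sup>L ?P ?g"
      using f f' g by (simp add: case_prod_beta')
    also have "\<dots> \<le> (2 - q) / 2 * (1 / ?d + 1 / ?d) + (q - 1) * (1 / ?d)"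
      using f f' g q by (intro add_mono mult_left_mono) auto
    also have "\<dots> = 1 / ?d" by (simp add: field_simps)
    finally show "(\<integral>(y, x). w y * w x * (t y x)\<^sup>2 \<partial>?P) \<le> 1 / ?d" .
  qed

  have z_le: "\<bar>w y * w x * z k y x\<bar> \<le> w y * w x" for k y x
  proof (cases "w y = 0 \<or> w x = 0")
    case False
    then have "\<bar>z k y x\<bar> \<le> 1"
      unfolding z_def t_def by (intro abs_zonal_le_1 d w_sgn) auto
    then show ?thesis using w_nonneg by (simp add: abs_mult mult_left_le)
  qed auto
  have int_z: "integrable ?P (\<lambda>(y, x). w y * w x * z k y x)" for k
    by (rule Bochner_Integration.integrable_bound[OF int_ww])
      (use z_le w_nonneg in \<open>auto intro!: AE_I2\<close>)
  \<comment> \<open>At t = 1 all zonal functions are 1, so the hypothesis there is convergence of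
    the coefficients themselves, and it is absolute because they have one sign. With the bound of
    the zonal functions by 1 this dominates the series and permits termwise integration.\<close>
  have "summable (\<lambda>k. a (k + 2))"
    using summable[of 1] d by (simp add: zonal_at_1)
  then have summable_abs: "summable (\<lambda>k. \<bar>a (k + 2)\<bar>)"
    using a(3) by (simp add: summable_minus_iff abs_of_nonpos)
  let ?F = "\<lambda>k p. a (k + 2) * (w (fst p) * w (snd p) * z k (fst p) (snd p))"
  have F_le: "\<bar>?F k p\<bar> \<le> \<bar>a (k + 2)\<bar> * (w (fst p) * w (snd p))" for k p
    using z_le by (simp add: abs_mult mult_left_mono)
  have int_F: "integrable ?P (?F k)" for k
    using int_z[of k] by (simp add: case_prod_beta')
  have "summable (\<lambda>k. norm (?F k p))" for p
    by (rule summable_comparison_test'[OF summable_mult2[OF summable_abs], of 0])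
      (unfold real_norm_def abs_abs, rule F_le)
  then have sum_F: "AE p in ?P. summable (\<lambda>k. norm (?F k p))" by simp
  have sum_int_F: "summable (\<lambda>k. \<integral>p. norm (?F k p) \<partial>?P)"
  proof (rule summable_comparison_test'[OF summable_mult2[OF summable_abs]])
    fix k :: nat
    have "(\<integral>p. norm (?F k p) \<partial>?P) \<le> (\<integral>p. \<bar>a (k + 2)\<bar> * (w (fst p) * w (snd p)) \<partial>?P)"
      using int_F int_ww F_le by (intro integral_mono) (auto simp: case_prod_beta')
    then show "norm (\<integral>p. norm (?F k p) \<partial>?P) \<le> \<bar>a (k + 2)\<bar> * (\<integral>p. w (fst p) * w (snd p) \<partial>?P)"
      by (simp add: integral_nonneg_AE)
  qed
  have F_S: "(\<Sum>k. ?F k (y, x)) = w y * w x * S y x" for y x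
    using summable[OF t_01] unfolding S_def z_def
    by (subst suminf_mult[symmetric]) (auto simp: mult_ac)
  then have F_S': "(\<lambda>p. \<Sum>k. ?F k p) = (\<lambda>(y, x). w y * w x * S y x)" by auto
  have int_S: "integrable ?P (\<lambda>(y, x). w y * w x * S y x)"
    using integrable_suminf[OF int_F sum_F sum_int_F] unfolding F_S' .
  have wwS: "(\<integral>(y, x). w y * w x * S y x \<partial>?P) \<le> 0"
  proof -
    have F_nonpos: "integral\<^sup>L ?P (?F k) \<le> 0" for k
    proof -
      have "0 \<le> (\<integral>p. w (fst p) * w (snd p) * z k (fst p) (snd p) \<partial>?P)"
        using zonal_positive_definite[where s = sgn and k = "k + 2",
            OF d sigma_finite_measure_axioms int_w _ w_sgn]
        by (simp add: z_def t_def case_prod_beta')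
      then show ?thesis using a(3)[of "k + 2"] by (simp add: mult_nonpos_nonneg)
    qed
    have "(\<integral>(y, x). w y * w x * S y x \<partial>?P) = (\<Sum>k. integral\<^sup>L ?P (?F k))"
      using integral_suminf[OF int_F sum_F sum_int_F] unfolding F_S' .
    also have "\<dots> \<le> (\<Sum>k. 0)"
      by (intro suminf_le F_nonpos summable_integral[OF int_F sum_F sum_int_F]) simp
    finally show ?thesis by simp
  qed

  let ?G = "\<lambda>p. a 0 * (w (fst p) * w (snd p)) + a 1 * (w (fst p) * w (snd p) * (t (fst p) (snd p))\<^sup>2) +
    w (fst p) * w (snd p) * S (fst p) (snd p)"
  have G_le: "norm (hinner x y) powr q \<le> ?G (y, x)" for x y
  proof -
    have "norm (hinner x y) powr q = w y * w x * t y x powr q"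
      using norm_hinner_polar[of x y] t_commute[of x y] by (simp add: w_def t_def powr_mult)
    also have "\<dots> \<le> w y * w x * (a 0 + a 1 * (t y x)\<^sup>2 + S y x)"
      unfolding S_def z_def by (intro mult_left_mono le t_01 mult_nonneg_nonneg w_nonneg)
    finally show ?thesis by (simp add: algebra_simps)
  qed
  have int_G: "integrable ?P ?G"
    using int_ww int_wwt int_S by (simp add: case_prod_beta')
  have "moment q \<mu> = (\<integral>\<^sup>+p. ennreal (norm (hinner (snd p) (fst p)) powr q) \<partial>?P)"
    unfolding moment_def by (subst nn_integral_fst[symmetric]) auto
  also have "\<dots> \<le> (\<integral>\<^sup>+p. ennreal (?G p) \<partial>?P)"
  proof (intro nn_integral_mono ennreal_leI)
    fix p
    show "norm (hinner (snd p) (fst p)) powr q \<le> ?G p"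
      using G_le[of "snd p" "fst p"] by simp
  qed
  also have "\<dots> = ennreal (integral\<^sup>L ?P ?G)"
  proof (rule nn_integral_eq_integral[OF int_G AE_I2])
    fix p
    show "0 \<le> ?G p" using order_trans[OF powr_ge_zero G_le[of "snd p" "fst p"]] by simp
  qed
  also have "integral\<^sup>L ?P ?G = a 0 * (\<integral>(y, x). w y * w x \<partial>?P) +
      a 1 * (\<integral>(y, x). w y * w x * (t y x)\<^sup>2 \<partial>?P) + (\<integral>(y, x). w y * w x * S y x \<partial>?P)"
    using int_ww int_wwt int_S by (simp add: case_prod_beta')
  also have "ennreal \<dots> \<le> ennreal (a 0 * 1 + a 1 * (1 / ?d) + 0)"
    using a ww wwt wwS by (intro ennreal_leI add_mono mult_left_mono) auto
  finally show ?thesis by (simp add: add.commute)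
qed

theorem corollary2:
  fixes q :: real and a :: "nat \<Rightarrow> real" and m :: nat
  assumes "CARD('n::finite) \<ge> 2"
    and "1 \<le> q" and "q \<le> 2"
    and "a 0 \<ge> 0" and "a 1 \<ge> 0" and "\<And>k. k \<ge> 2 \<Longrightarrow> a k \<le> 0"
    and "\<And>t. 0 \<le> t \<Longrightarrow> t \<le> 1 \<Longrightarrow> summable (\<lambda>k. a (k + 2) * zonal m CARD('n) (k + 2) t)"
    and "\<And>t. 0 \<le> t \<Longrightarrow> t \<le> 1 \<Longrightarrow>
      t powr q \<le> a 0 + a 1 * t\<^sup>2 + (\<Sum>k. a (k + 2) * zonal m CARD('n) (k + 2) t)"
  shows
    "(m = DIM(real) \<longrightarrow> (\<forall>\<mu> :: (real ^ 'n) measure.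
        isotropic \<mu> \<longrightarrow> moment q \<mu> \<le> ennreal (a 1 / real CARD('n) + a 0))) \<and>
     (m = DIM(complex) \<longrightarrow> (\<forall>\<mu> :: (complex ^ 'n) measure.
        isotropic \<mu> \<longrightarrow> moment q \<mu> \<le> ennreal (a 1 / real CARD('n) + a 0))) \<and>
     (m = DIM(quat) \<longrightarrow> (\<forall>\<mu> :: (quat ^ 'n) measure.
        isotropic \<mu> \<longrightarrow> moment q \<mu> \<le> ennreal (a 1 / real CARD('n) + a 0)))"
proof (intro conjI impI allI)
  fix \<mu> :: "(real ^ 'n) measure"
  assume m: "m = DIM(real)" and \<mu>: "isotropic \<mu>"
  show "moment q \<mu> \<le> ennreal (a 1 / real CARD('n) + a 0)"
    by (rule isotropic_measure.moment_le[OF isotropic_measure.intro[OF \<mu>] assms[unfolded m]])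
next
  fix \<mu> :: "(complex ^ 'n) measure"
  assume m: "m = DIM(complex)" and \<mu>: "isotropic \<mu>"
  show "moment q \<mu> \<le> ennreal (a 1 / real CARD('n) + a 0)"
    by (rule isotropic_measure.moment_le[OF isotropic_measure.intro[OF \<mu>] assms[unfolded m]])
next
  fix \<mu> :: "(quat ^ 'n) measure"
  assume m: "m = DIM(quat)" and \<mu>: "isotropic \<mu>"
  show "moment q \<mu> \<le> ennreal (a 1 / real CARD('n) + a 0)"
    by (rule isotropic_measure.moment_le[OF isotropic_measure.intro[OF \<mu>] assms[unfolded m]])
qed

end
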